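(* For all integers $n \geq 0$, $$\overline{t}(80n+40) \equiv 0 \pmod{5} \qquad\text{and}\qquad \overline{t}(80n+60) \equiv 0 \pmod{5}.$$
   Context: An overpartition of $n$ is a partition of $n$ (a non-increasing sequence of positive integers with sum $n$) in which the final occurrence of each number may be overlined or not. The function $\overline{t}(n)$ counts the overpartitions of $n$ satisfying: (i) the difference between two successive parts may be odd only if the larger part is overlined; (ii) if the smallest part is odd, then it is overlined. For example, $\overline{t}(4)=8$. Here $\overline{t}(0)=1$. It is known that its generating function is $$\sum_{n\ge 0}\overline{t}(n)q^n = \prod_{n\ge 1}\frac{1-q^{3n}}{(1-q^{2n})(1-q^{n})},$$ which may be taken as the definition of $\overline{t}(n)$. *)

theory Defs
  imports "HOL-Analysis.Analysis" "HOL-Computational_Algebra.Formal_Power_Series"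
    "HOL-Number_Theory.Cong"
begin

(* The index is shifted: the n-th factor below, n = 0, 1, 2, ..., belongs to q^(n + 1). *)
definition tbar_factor :: "nat \<Rightarrow> rat fps" where
  "tbar_factor n =
     (1 - fps_X ^ (3 * (n + 1))) / ((1 - fps_X ^ (2 * (n + 1))) * (1 - fps_X ^ (n + 1)))"

definition tbar_gf :: "rat fps" where
  "tbar_gf = (\<Prod>n. tbar_factor n)"

(* Rational power series are used because division is not available over the integers.
   The coefficients are integers and the product converges in the topology of formal
   power series: see of_int_tbar and tbar_factor_has_prod below. *)
definition tbar :: "nat \<Rightarrow> int" where
  "tbar n = (THE k. of_int k = fps_nth tbar_gf n)"

lemma fps_has_prodI:
  fixes f :: "nat \<Rightarrow> 'a :: idom fps"
  assumes "\<And>i. \<exists>D. f i = 1 + fps_X ^ Suc i * D"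
  shows "f has_prod Abs_fps (\<lambda>m. fps_nth (\<Prod>i\<le>m. f i) m)"
proof -
  let ?P = "Abs_fps (\<lambda>m. fps_nth (\<Prod>i\<le>m. f i) m)"
  obtain D where D: "\<And>i. f i = 1 + fps_X ^ Suc i * D i"
    using assms by metis
  have step: "fps_nth (g * f i) m = fps_nth g m" if "m \<le> i" for g i m
  proof -
    have "g * f i = g + fps_X ^ Suc i * (D i * g)"
      by (simp add: D algebra_simps)
    then show ?thesis
      using that by (simp only: fps_add_nth fps_X_power_mult_nth) simp
  qed
  have stab: "fps_nth (\<Prod>i\<le>N. f i) m = fps_nth ?P m" if "m \<le> N" for N m
    using that
  proof (induction N rule: dec_induct)
    case base
    show ?case by simp
  next
    case (step N)
    have "fps_nth (\<Prod>i\<le>Suc N. f i) m = fps_nth ((\<Prod>i\<le>N. f i) * f (Suc N)) m"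
      by simp
    also have "\<dots> = fps_nth (\<Prod>i\<le>N. f i) m"
      using step.hyps by (intro \<open>\<And>g i m. m \<le> i \<Longrightarrow> fps_nth (g * f i) m = fps_nth g m\<close>) simp
    finally show ?case using step.IH by simp
  qed
  have lim: "(\<lambda>N. \<Prod>i\<le>N. f i) \<longlonglongrightarrow> ?P"
    by (intro tendsto_fpsI eventually_at_top_linorderI stab)
  have "fps_nth ?P 0 = 1"
    by (simp add: D)
  then have "?P \<noteq> 0"
    by (metis fps_zero_nth zero_neq_one)
  with lim show ?thesis
    by (simp add: has_prod_def raw_has_prod_def)
qed

lemma tbar_factor_eq: "\<exists>D. tbar_factor i = 1 + fps_X ^ Suc i * D"
proof -
  define x :: "rat fps" where "x = fps_X ^ Suc i"
  define E where "E = (1 - x ^ 2) * (1 - x)"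
  have x0: "fps_nth x 0 = 0"
    by (simp add: x_def)
  then have "fps_nth E 0 = 1"
    by (simp add: E_def power2_eq_square)
  then have E0: "fps_nth E 0 \<noteq> 0" by simp
  have "tbar_factor i = (1 - x ^ 3) / E"
    unfolding tbar_factor_def x_def E_def by (simp only: power_mult [symmetric] mult.commute Suc_eq_plus1)
  also have "1 - x ^ 3 = E + x * (1 + x - 2 * x ^ 2)"
    by (simp add: E_def algebra_simps power2_eq_square power3_eq_cube)
  also have "(E + x * (1 + x - 2 * x ^ 2)) / E = (E + x * (1 + x - 2 * x ^ 2)) * inverse E"
    by (rule fps_divide_unit [OF E0])
  also have "\<dots> = 1 + x * ((1 + x - 2 * x ^ 2) * inverse E)"
    using inverse_mult_eq_1' [OF E0] by (simp add: algebra_simps)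
  finally show ?thesis
    unfolding x_def by blast
qed

lemma tbar_factor_has_prod: "tbar_factor has_prod tbar_gf"
  unfolding tbar_gf_def
  using has_prod_unique [OF fps_has_prodI [of tbar_factor, OF tbar_factor_eq]]
    fps_has_prodI [of tbar_factor, OF tbar_factor_eq] by simp

lemma tbar_gf_nth: "fps_nth tbar_gf m = fps_nth (\<Prod>i\<le>m. tbar_factor i) m"
  unfolding tbar_gf_def
  by (simp only: has_prod_unique [OF fps_has_prodI [of tbar_factor, OF tbar_factor_eq], symmetric]
      fps_nth_Abs_fps)

lemma fps_inverse_in_Ints:
  fixes f :: "rat fps"
  assumes "fps_nth f 0 = 1" and "\<And>m. fps_nth f m \<in> \<int>"
  shows "fps_nth (inverse f) m \<in> \<int>"
proof (induction m rule: less_induct)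
  case (less m)
  show ?case
  proof (cases m)
    case 0
    then show ?thesis using assms(1) by simp
  next
    case (Suc k)
    have "fps_nth (inverse f) m = - (\<Sum>i=1..m. fps_nth f i * fps_nth (inverse f) (m - i))"
      using assms(1) Suc by (simp add: fps_inverse_def)
    also have "\<dots> \<in> \<int>"
      using assms(2) less.IH by (intro Ints_minus Ints_sum Ints_mult) auto
    finally show ?thesis .
  qed
qed

lemma fps_mult_in_Ints:
  fixes f g :: "rat fps"
  assumes "\<And>m. fps_nth f m \<in> \<int>" and "\<And>m. fps_nth g m \<in> \<int>"
  shows "fps_nth (f * g) m \<in> \<int>"
  unfolding fps_mult_nth using assms by (intro Ints_sum Ints_mult) auto

lemma tbar_factor_in_Ints: "fps_nth (tbar_factor i) m \<in> \<int>"
proof -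
  have int: "fps_nth (1 - fps_X ^ k :: rat fps) m \<in> \<int>" for k m
    by simp
  let ?E = "(1 - fps_X ^ (2 * (i + 1))) * (1 - fps_X ^ (i + 1)) :: rat fps"
  have E0: "fps_nth ?E 0 = 1"
    by simp
  then have "tbar_factor i = (1 - fps_X ^ (3 * (i + 1))) * inverse ?E"
    unfolding tbar_factor_def by (intro fps_divide_unit) simp
  then show ?thesis
    by (simp only:) (intro fps_mult_in_Ints int fps_inverse_in_Ints [OF E0])
qed

lemma tbar_gf_in_Ints: "fps_nth tbar_gf m \<in> \<int>"
proof -
  have "fps_nth (\<Prod>i\<le>N. tbar_factor i) m \<in> \<int>" for N m
    by (induction N arbitrary: m)
      (simp_all only: prod.atMost_Suc atMost_0 prod.insert finite.emptyI empty_iff prod.empty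
        mult_1_right not_False_eq_True tbar_factor_in_Ints fps_mult_in_Ints)
  then show ?thesis
    by (simp only: tbar_gf_nth)
qed

lemma of_int_tbar: "of_int (tbar n) = fps_nth tbar_gf n"
proof -
  obtain k where "fps_nth tbar_gf n = of_int k"
    using tbar_gf_in_Ints [of n] by (elim Ints_cases)
  then show ?thesis
    by (simp add: tbar_def)
qed

end

theory Submission
  imports Defs
begin

text \<open>Write \<open>\<phi>(q)\<close> for the sum of \<open>q^(n^2)\<close> over all integers, \<open>\<psi>(q)\<close> for the sum of
  \<open>q^(n(n+1)/2)\<close> over the natural numbers, \<open>f_k\<close> for the product of all \<open>1 - q^(kn)\<close>, and
  \<open>\<Theta> = q d/dq\<close>. Since \<open>80n + 40 = 4(20n + 10)\<close> and \<open>80n + 60 = 4(20n + 15)\<close>, the claim concerns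
  the coefficients of \<open>T = \<Sum> tbar(4n) q^n\<close> at exponents that are divisible by 5 and congruent to 2 or 3
  modulo 4.

  The mechanism is exactness in characteristic 5: a series of the form \<open>\<Theta>Z\<close> has coefficients divisible
  by 5 at all exponents divisible by 5. Fifth powers are constants for \<open>\<Theta>\<close> modulo 5, so exactness
  modulo 5 is not affected by multiplication with fifth powers of invertible series.

  Two dissections modulo 2 give
  \<open>T = \<phi>(-q)^(-5) \<sqdot> \<phi>(-q) \<phi>(-q^3) \<psi>(-q^2) \<psi>(-q^6) \<phi>(-q^4) / f_24\<close> (lemma \<open>tbar4_series_theta\<close>).
  The theta functions split explicitly by the residue of the exponent modulo 4, and because the
  denominator is a fifth power, its splitting modulo 5 consists of fifth powers as well. The parts of
  \<open>T\<close> at the residues 2 and 3 turn out to be, modulo 5, fifth powers, times the scalar 2 and a power of \<open>q\<close> in the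
  second case, times one common series \<open>F\<close>. So a single exactness statement about \<open>F\<close> gives both
  congruences.

  To prove it (lemma \<open>mod5_exact_theta_form\<close>), put \<open>A = \<phi>(q)^2\<close>, \<open>C = \<phi>(q^3)^2\<close> and \<open>x = A/C\<close>. The relations
  of degree 3 express \<open>F\<close>, up to fifth powers, through \<open>x\<close> and \<open>C\<close>, and they evaluate \<open>\<Theta>x\<close> as
  \<open>C^2 (x-1)(x+3)(3-x)(x+1)/16\<close>. As a result
  \<open>q^3 F\<close> becomes, up to fifth powers, \<open>R(x) \<Theta>x\<close> with a polynomial \<open>R\<close> of degree 21. Modulo 5, the form
  \<open>R(x) dx\<close> has a polynomial primitive exactly when the coefficients of \<open>x^4\<close>, \<open>x^9\<close>, \<open>x^14\<close>, \<open>x^19\<close> vanish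
  modulo 5, which they do.

  The relations of degree 3 are obtained without modular forms. The modular equation
  \<open>\<phi>(q)\<phi>(q^3) - \<phi>(-q)\<phi>(-q^3) = 4q \<psi>(q^2)\<psi>(q^6)\<close> counts the representations by \<open>x^2 + 3y^2\<close> in two ways.
  The differential equation \<open>4 \<Theta> log (q^(1/4) \<psi>(q^2)/\<phi>(q)) = \<phi>(-q)^4\<close> holds because both sides behave in
  the same way under \<open>q \<mapsto> q^2\<close> (lemma \<open>theta_wronskian\<close>). Differentiating the modular equation then
  yields the multiplier equation and with it all algebraic relations that are needed. The products
  for the theta functions come from the triple product identity.\<close>

unbundle no vec_syntax
unbundle fps_syntax

section \<open>Substitutions, sections and the Euler derivation\<close>

definition dil :: "nat \<Rightarrow> int fps \<Rightarrow> int fps" where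
  "dil k F = F oo fps_X ^ k"

lemma dil_nth:
  assumes "k > 0"
  shows "dil k F $ n = (if k dvd n then F $ (n div k) else 0)"
proof -
  have "dil k F $ n = (\<Sum>i=0..n. if n = k * i then F $ i else 0)"
    by (simp add: dil_def fps_compose_nth power_mult [symmetric] fps_X_power_nth if_distrib cong: if_cong)
  also have "\<dots> = (if k dvd n then F $ (n div k) else 0)"
  proof (cases "k dvd n")
    case True
    then obtain m where m: "n = k * m" by blast
    have "m \<le> n" using assms m by simp
    have "(\<Sum>i=0..n. if n = k * i then F $ i else 0) = (\<Sum>i=0..n. if m = i then F $ i else 0)"
      using assms m by (intro sum.cong) auto
    then show ?thesis using \<open>m \<le> n\<close> assms m by simp
  next
    case False
    then show ?thesis by (auto intro!: sum.neutral)
  qed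
  finally show ?thesis .
qed

lemma dil_add: "dil k (F + G) = dil k F + dil k G"
  by (simp add: dil_def fps_compose_add_distrib)

lemma dil_diff: "dil k (F - G) = dil k F - dil k G"
  by (simp add: dil_def fps_compose_sub_distrib)

lemma dil_uminus: "dil k (- F) = - dil k F"
  by (simp add: dil_def fps_compose_uminus)

lemma dil_mult: "k > 0 \<Longrightarrow> dil k (F * G) = dil k F * dil k G"
  by (simp add: dil_def fps_compose_mult_distrib)

lemma dil_power: "k > 0 \<Longrightarrow> dil k (F ^ n) = dil k F ^ n"
  by (simp add: dil_def fps_compose_power)

lemma dil_numeral: "dil k (numeral n) = numeral n"
  by (simp add: dil_def)

lemma dil_1: "dil k 1 = 1"
  by (simp add: dil_def)

lemma dil_X: "k > 0 \<Longrightarrow> dil k fps_X = fps_X ^ k"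
  by (simp add: dil_def)

lemmas dil_simps = dil_add dil_diff dil_uminus dil_mult dil_power dil_numeral dil_1 dil_X

lemma dil_dil:
  assumes "j > 0" "k > 0"
  shows "dil j (dil k F) = dil (j * k) F"
proof (rule fps_ext)
  fix n
  show "dil j (dil k F) $ n = dil (j * k) F $ n"
    using assms by (auto simp: dil_nth div_mult2_eq dvd_div_iff_mult mult.commute
        dest: dvd_mult_left dvd_mult_right)
qed

lemma dil_inject:
  assumes "k > 0"
  shows "dil k F = dil k G \<longleftrightarrow> F = G"
proof
  assume eq: "dil k F = dil k G"
  show "F = G"
  proof (rule fps_ext)
    fix n
    from eq have "dil k F $ (k * n) = dil k G $ (k * n)" by simp
    with assms show "F $ n = G $ n" by (simp add: dil_nth)
  qed
qed simp

definition alt :: "int fps \<Rightarrow> int fps" where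
  "alt F = F oo - fps_X"

lemma alt_nth: "alt F $ n = (- 1) ^ n * F $ n"
proof -
  have "(- fps_X :: int fps) ^ i $ n = (if i = n then (- 1) ^ n else 0)" for i
    by (cases "even i") (auto simp: power_minus_odd fps_X_power_nth)
  then have "alt F $ n = (\<Sum>i=0..n. if i = n then (- 1) ^ n * F $ n else 0)"
    unfolding alt_def fps_compose_nth by (intro sum.cong) auto
  then show ?thesis by simp
qed

lemma alt_add: "alt (F + G) = alt F + alt G"
  by (simp add: alt_def fps_compose_add_distrib)

lemma alt_diff: "alt (F - G) = alt F - alt G"
  by (simp add: alt_def fps_compose_sub_distrib)

lemma alt_mult: "alt (F * G) = alt F * alt G"
  by (simp add: alt_def fps_compose_mult_distrib)

lemma alt_power: "alt (F ^ n) = alt F ^ n"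
  by (simp add: alt_def fps_compose_power)

lemma alt_numeral: "alt (numeral n) = numeral n"
  by (simp add: alt_def)

lemma alt_1: "alt 1 = 1"
  by (simp add: alt_def)

lemma alt_X: "alt fps_X = - fps_X"
  by (simp add: alt_def)

lemma alt_alt: "alt (alt F) = F"
  by (rule fps_ext) (simp add: alt_nth flip: mult.assoc power_mult_distrib)

lemma alt_dil_even:
  assumes "even k" "k > 0"
  shows "alt (dil k F) = dil k F"
  by (rule fps_ext) (use assms in \<open>auto simp: alt_nth dil_nth elim!: dvdE\<close>)

lemma alt_dil_odd:
  assumes "odd k"
  shows "alt (dil k F) = dil k (alt F)"
proof (rule fps_ext)
  fix n
  have "k > 0" using assms by (rule odd_pos)
  then show "alt (dil k F) $ n = dil k (alt F) $ n"
    using assms by (auto simp: alt_nth dil_nth power_mult elim!: dvdE)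
qed

lemmas alt_simps = alt_add alt_diff alt_mult alt_power alt_numeral alt_1 alt_X

definition sec :: "nat \<Rightarrow> nat \<Rightarrow> int fps \<Rightarrow> int fps" where
  "sec k r F = Abs_fps (\<lambda>n. F $ (k * n + r))"

lemma sec_nth [simp]: "sec k r F $ n = F $ (k * n + r)"
  by (simp add: sec_def)

lemma sec_add: "sec k r (F + G) = sec k r F + sec k r G"
  by (rule fps_ext) simp

lemma sec_diff: "sec k r (F - G) = sec k r F - sec k r G"
  by (rule fps_ext) simp

text \<open>Series in \<open>q^k\<close> are scalars for the extraction of residue classes modulo \<open>k\<close>. This is how all
  dissections below are evaluated.\<close>

lemma sec_dil_mult:
  assumes "r < k"
  shows "sec k r (dil k F * G) = F * sec k r G"
proof (rule fps_ext)
  fix n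
  have k: "k > 0" using assms by simp
  have *: "k * j \<le> k * n + r \<longleftrightarrow> j \<le> n" for j
  proof
    assume "k * j \<le> k * n + r"
    also have "\<dots> < k * Suc n" using assms by simp
    finally show "j \<le> n" by (simp only: mult_less_cancel1 less_Suc_eq_le)
  next
    assume "j \<le> n"
    then have "k * j \<le> k * n" by (rule mult_le_mono2)
    then show "k * j \<le> k * n + r" by linarith
  qed
  have "sec k r (dil k F * G) $ n = (\<Sum>i=0..k * n + r. dil k F $ i * G $ (k * n + r - i))"
    by (simp add: fps_mult_nth)
  also have "\<dots> = (\<Sum>i\<in>(\<lambda>j. k * j) ` {0..n}. dil k F $ i * G $ (k * n + r - i))"
    using k by (intro sum.mono_neutral_right) (auto simp: dil_nth * elim!: dvdE)
  also have "\<dots> = (\<Sum>j=0..n. F $ j * G $ (k * n + r - k * j))"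
    using k by (subst sum.reindex) (auto simp: inj_on_def dil_nth)
  also have "\<dots> = (\<Sum>j=0..n. F $ j * sec k r G $ (n - j))"
    by (intro sum.cong) (auto simp: diff_mult_distrib2)
  finally show "sec k r (dil k F * G) $ n = (F * sec k r G) $ n"
    by (simp add: fps_mult_nth)
qed

lemma sec_X_power:
  assumes "r < k" "s < k"
  shows "sec k r (fps_X ^ s) = (if s = r then 1 else 0)"
proof (rule fps_ext)
  fix n
  have "k * n + r = s \<longleftrightarrow> n = 0 \<and> s = r"
    using assms by (cases n) auto
  then show "sec k r (fps_X ^ s) $ n = (if s = r then 1 else 0) $ n"
    by (auto simp: fps_X_power_nth)
qed

lemma sec_dil_X_power:
  assumes "r < k" "s < k"
  shows "sec k r (dil k F * fps_X ^ s) = (if s = r then F else 0)"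
  using assms by (simp add: sec_dil_mult sec_X_power)

lemma sec_dil: "r < k \<Longrightarrow> sec k r (dil k F) = (if r = 0 then F else 0)"
  using sec_dil_X_power [of r k 0 F] by simp

definition qderiv :: "int fps \<Rightarrow> int fps" where
  "qderiv F = fps_X * fps_deriv F"

lemma qderiv_nth: "qderiv F $ n = int n * F $ n"
  by (cases n) (simp_all add: qderiv_def)

lemma qderiv_add: "qderiv (F + G) = qderiv F + qderiv G"
  by (simp add: qderiv_def algebra_simps)

lemma qderiv_diff: "qderiv (F - G) = qderiv F - qderiv G"
  by (simp add: qderiv_def algebra_simps)

lemma qderiv_mult: "qderiv (F * G) = qderiv F * G + F * qderiv G"
  by (simp add: qderiv_def algebra_simps)

lemma qderiv_numeral: "qderiv (numeral n) = 0"
  by (simp add: qderiv_def)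

lemma qderiv_X: "qderiv fps_X = fps_X"
  by (simp add: qderiv_def)

lemma qderiv_power: "qderiv (F ^ n) = of_nat n * F ^ (n - 1) * qderiv F"
proof (induction n)
  case 0
  show ?case by (simp add: qderiv_def)
next
  case (Suc n)
  have "F * qderiv (F ^ n) = of_nat n * F ^ n * qderiv F"
  proof (cases n)
    case 0
    then show ?thesis by (simp add: qderiv_def)
  next
    case (Suc m)
    show ?thesis by (simp only: Suc.IH) (simp add: Suc algebra_simps)
  qed
  then show ?case
    by (simp add: qderiv_mult algebra_simps)
qed

lemmas qderiv_simps = qderiv_add qderiv_diff qderiv_mult qderiv_numeral qderiv_X qderiv_power

lemma qderiv_dil:
  assumes "k > 0"
  shows "qderiv (dil k F) = of_nat k * dil k (qderiv F)"
  by (rule fps_ext) (use assms in \<open>auto simp: qderiv_nth dil_nth fps_of_nat [symmetric] elim!: dvdE\<close>)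

lemma fps_unit_inverse:
  fixes F :: "int fps"
  assumes "F $ 0 = 1"
  obtains G where "F * G = 1" and "G $ 0 = 1"
proof
  show "F * fps_right_inverse F 1 = 1"
    using assms by (intro fps_right_inverse) simp
  show "fps_right_inverse F 1 $ 0 = 1" by simp
qed

lemma fps_nonzero_if_nth_0: "F $ 0 = 1 \<Longrightarrow> F \<noteq> (0 :: int fps)"
  by auto

text \<open>Square roots of series with constant coefficient 1 are unique, since \<open>F + G\<close> is not zero.\<close>

lemma fps_square_eq_imp_eq:
  fixes F G :: "int fps"
  assumes "F\<^sup>2 = G\<^sup>2" "F $ 0 = 1" "G $ 0 = 1"
  shows "F = G"
proof -
  have "(F - G) * (F + G) = 0"
    using assms(1) by (simp add: algebra_simps power2_eq_square)
  moreover have "(F + G) $ 0 \<noteq> 0" using assms by simp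
  then have "F + G \<noteq> 0" by (metis fps_zero_nth)
  ultimately show ?thesis by simp
qed

section \<open>Counting series\<close>

text \<open>In this form identities between theta series become bijections between index sets. Since \<open>card\<close> is 0 on
  infinite sets, sums and products of such series require finite fibers.\<close>

definition gf :: "'a set \<Rightarrow> ('a \<Rightarrow> nat) \<Rightarrow> int fps" where
  "gf S w = Abs_fps (\<lambda>n. int (card {x \<in> S. w x = n}))"

definition finite_fibers :: "'a set \<Rightarrow> ('a \<Rightarrow> nat) \<Rightarrow> bool" where
  "finite_fibers S w \<longleftrightarrow> (\<forall>n. finite {x \<in> S. w x = n})"

lemma gf_nth: "gf S w $ n = int (card {x \<in> S. w x = n})"
  by (simp add: gf_def)

lemma gf_bij:
  assumes "bij_betw f S T" "\<And>x. x \<in> S \<Longrightarrow> v (f x) = w x"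
  shows "gf S w = gf T v"
proof (rule fps_ext)
  fix n
  have "bij_betw f {x \<in> S. w x = n} {y \<in> T. v y = n}"
    using assms unfolding bij_betw_def by (auto simp: inj_on_def)
  then show "gf S w $ n = gf T v $ n"
    by (simp add: gf_nth bij_betw_same_card)
qed

lemma gf_cong: "S = T \<Longrightarrow> (\<And>x. x \<in> T \<Longrightarrow> w x = v x) \<Longrightarrow> gf S w = gf T v"
  using gf_bij [of "\<lambda>x. x" S T v w] by (simp add: bij_betw_def)

lemma gf_Un:
  assumes "finite_fibers S w" "finite_fibers T w" "S \<inter> T = {}"
  shows "gf (S \<union> T) w = gf S w + gf T w"
proof (rule fps_ext)
  fix n
  have "{x \<in> S \<union> T. w x = n} = {x \<in> S. w x = n} \<union> {x \<in> T. w x = n}" by auto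
  moreover have "card \<dots> = card {x \<in> S. w x = n} + card {x \<in> T. w x = n}"
    using assms by (intro card_Un_disjoint) (auto simp: finite_fibers_def)
  ultimately show "gf (S \<union> T) w $ n = (gf S w + gf T w) $ n"
    by (simp add: gf_nth)
qed

lemma gf_Times:
  assumes "finite_fibers S w" "finite_fibers T v"
  shows "gf (S \<times> T) (\<lambda>(x, y). w x + v y) = gf S w * gf T v"
proof (rule fps_ext)
  fix n
  have "{p \<in> S \<times> T. (case p of (x, y) \<Rightarrow> w x + v y) = n} =
      (\<Union>i\<in>{0..n}. {x \<in> S. w x = i} \<times> {y \<in> T. v y = n - i})"
    by auto
  also have "card \<dots> = (\<Sum>i\<in>{0..n}. card ({x \<in> S. w x = i} \<times> {y \<in> T. v y = n - i}))"
    using assms by (intro card_UN_disjoint) (auto simp: finite_fibers_def)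
  finally show "gf (S \<times> T) (\<lambda>(x, y). w x + v y) $ n = (gf S w * gf T v) $ n"
    by (simp add: gf_nth fps_mult_nth card_cartesian_product)
qed

lemma gf_scale:
  assumes "k > 0"
  shows "gf S (\<lambda>x. k * w x) = dil k (gf S w)"
proof (rule fps_ext)
  fix n
  show "gf S (\<lambda>x. k * w x) $ n = dil k (gf S w) $ n"
  proof (cases "k dvd n")
    case True
    then obtain m where m: "n = k * m" by blast
    then have "{x \<in> S. k * w x = n} = {x \<in> S. w x = m}"
      using assms by auto
    then show ?thesis using assms m by (simp add: gf_nth dil_nth)
  next
    case False
    then have *: "{x \<in> S. k * w x = n} = {}" by auto
    show ?thesis using assms False by (simp only: gf_nth dil_nth *) simp
  qed
qed

lemma gf_shift: "gf S (\<lambda>x. m + w x) = fps_X ^ m * gf S w"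
proof (rule fps_ext)
  fix n
  show "gf S (\<lambda>x. m + w x) $ n = (fps_X ^ m * gf S w) $ n"
    by (auto simp: gf_nth fps_X_power_mult_nth intro!: arg_cong [where f = card])
qed

section \<open>Theta functions and their dissections\<close>

definition phi :: "int fps" where
  "phi = gf (UNIV :: int set) (\<lambda>m. nat (m\<^sup>2))"

definition psi :: "int fps" where
  "psi = gf (UNIV :: nat set) (\<lambda>n. n * (n + 1) div 2)"

lemma finite_fibers_square: "finite_fibers (S :: int set) (\<lambda>m. nat (m\<^sup>2))"
  unfolding finite_fibers_def
proof
  fix n
  have "\<bar>m\<bar> \<le> int n" if "nat (m\<^sup>2) = n" for m :: int
  proof -
    have "m\<^sup>2 = int n" using that by auto
    moreover have "\<bar>m\<bar> * 1 \<le> \<bar>m\<bar> * \<bar>m\<bar>"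
    proof (cases "m = 0")
      case False
      then have "1 \<le> \<bar>m\<bar>" by simp
      then show ?thesis by (rule mult_left_mono) simp
    qed simp
    ultimately show ?thesis
      by (simp add: power2_eq_square)
  qed
  then have "{m \<in> S. nat (m\<^sup>2) = n} \<subseteq> {- int n..int n}"
    by (auto simp: abs_le_iff minus_le_iff)
  then show "finite {m \<in> S. nat (m\<^sup>2) = n}"
    by (rule finite_subset) simp
qed

lemma finite_fibers_scale:
  "finite_fibers S w \<Longrightarrow> k > 0 \<Longrightarrow> finite_fibers S (\<lambda>x. k * w x)"
  unfolding finite_fibers_def
proof
  fix n assume *: "\<forall>n. finite {x \<in> S. w x = n}" and "k > 0"
  then have "{x \<in> S. k * w x = n} \<subseteq> {x \<in> S. w x = n div k}" by auto
  with * show "finite {x \<in> S. k * w x = n}" using finite_subset by blast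
qed

lemma finite_fibers_Times:
  assumes "finite_fibers S w" "finite_fibers T v"
  shows "finite_fibers (S \<times> T) (\<lambda>(x, y). w x + v y)"
  unfolding finite_fibers_def
proof
  fix n
  have "{p \<in> S \<times> T. (case p of (x, y) \<Rightarrow> w x + v y) = n} \<subseteq>
      (\<Union>i\<in>{0..n}. {x \<in> S. w x = i} \<times> {y \<in> T. v y = n - i})"
    by auto
  moreover have "finite \<dots>" using assms by (auto simp: finite_fibers_def)
  ultimately show "finite {p \<in> S \<times> T. (case p of (x, y) \<Rightarrow> w x + v y) = n}"
    by (rule finite_subset)
qed

lemma finite_fibers_subset: "finite_fibers T w \<Longrightarrow> S \<subseteq> T \<Longrightarrow> finite_fibers S w"
  unfolding finite_fibers_def
proof
  fix n assume *: "\<forall>n. finite {x \<in> T. w x = n}" and "S \<subseteq> T"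
  then have "{x \<in> S. w x = n} \<subseteq> {x \<in> T. w x = n}" by auto
  with * show "finite {x \<in> S. w x = n}" using finite_subset by blast
qed

lemma gf_even_squares: "gf {m :: int. even m} (\<lambda>m. nat (m\<^sup>2)) = dil 4 phi"
proof -
  have "dil 4 phi = gf (UNIV :: int set) (\<lambda>m. 4 * nat (m\<^sup>2))"
    by (simp add: gf_scale phi_def)
  also have "\<dots> = gf {m. even m} (\<lambda>m. nat (m\<^sup>2))"
  proof (rule gf_bij)
    show "bij_betw (\<lambda>m. 2 * m :: int) UNIV {m. even m}"
      by (rule bij_betwI [where g = "\<lambda>m. m div 2"]) auto
    show "nat ((2 * m)\<^sup>2) = 4 * nat (m\<^sup>2)" for m :: int
      by (simp add: power_mult_distrib nat_mult_distrib)
  qed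
  finally show ?thesis by simp
qed

lemma gf_odd_squares: "gf {m :: int. odd m} (\<lambda>m. nat (m\<^sup>2)) = 2 * fps_X * dil 8 psi"
proof -
  have *: "gf (UNIV :: nat set) (\<lambda>n. 1 + 8 * (n * (n + 1) div 2)) = fps_X * dil 8 psi"
    by (simp only: gf_shift) (simp add: gf_scale psi_def)
  have sq: "nat ((2 * int n + 1)\<^sup>2) = 1 + 8 * (n * (n + 1) div 2)" for n
  proof -
    have "2 * (n * (n + 1) div 2) = n * (n + 1)"
      by (rule dvd_mult_div_cancel) simp
    moreover have "(2 * n + 1)\<^sup>2 = 1 + 4 * (n * (n + 1))"
      by (simp add: power2_eq_square algebra_simps)
    ultimately have "1 + 8 * (n * (n + 1) div 2) = (2 * n + 1)\<^sup>2"
      by linarith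
    moreover have "nat ((2 * int n + 1)\<^sup>2) = (2 * n + 1)\<^sup>2"
    proof -
      have "(2 * int n + 1)\<^sup>2 = int ((2 * n + 1)\<^sup>2)" by simp
      then show ?thesis by (simp only: nat_int)
    qed
    ultimately show ?thesis by (simp only:)
  qed
  have pos: "gf (UNIV :: nat set) (\<lambda>n. 1 + 8 * (n * (n + 1) div 2)) =
      gf {m :: int. odd m \<and> m > 0} (\<lambda>m. nat (m\<^sup>2))"
  proof (rule gf_bij)
    show "bij_betw (\<lambda>n. 2 * int n + 1) UNIV {m. odd m \<and> m > 0}"
      by (rule bij_betwI [where g = "\<lambda>m. nat (m div 2)"]) (auto elim!: oddE)
  qed (use sq in auto)
  have neg: "gf {m :: int. odd m \<and> m > 0} (\<lambda>m. nat (m\<^sup>2)) =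
      gf {m :: int. odd m \<and> m < 0} (\<lambda>m. nat (m\<^sup>2))"
    by (rule gf_bij [where f = uminus]) (auto intro!: bij_betwI [where g = uminus])
  have "{m :: int. odd m} = {m. odd m \<and> m > 0} \<union> {m. odd m \<and> m < 0}"
  proof -
    have "m > 0 \<or> m < 0" if "odd m" for m :: int
      using that by (cases m "0 :: int" rule: linorder_cases) auto
    then show ?thesis by blast
  qed
  then have "gf {m :: int. odd m} (\<lambda>m. nat (m\<^sup>2)) =
      gf ({m. odd m \<and> m > 0} \<union> {m :: int. odd m \<and> m < 0}) (\<lambda>m. nat (m\<^sup>2))"
    by (rule arg_cong)
  also have "\<dots> = gf {m :: int. odd m \<and> m > 0} (\<lambda>m. nat (m\<^sup>2)) +
      gf {m :: int. odd m \<and> m < 0} (\<lambda>m. nat (m\<^sup>2))"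
    by (rule gf_Un) (auto intro: finite_fibers_square)
  also have "\<dots> = 2 * fps_X * dil 8 psi"
    by (simp only: neg [symmetric] pos [symmetric] *) (simp add: mult.assoc)
  finally show ?thesis .
qed

text \<open>Even and odd squares; an odd square is 1 plus 8 times a triangular number.\<close>

lemma phi_split: "phi = dil 4 phi + 2 * fps_X * dil 8 psi"
proof -
  have "phi = gf ({m. even m} \<union> {m. odd m}) (\<lambda>m :: int. nat (m\<^sup>2))"
    unfolding phi_def by (rule gf_cong) auto
  also have "\<dots> = gf {m. even m} (\<lambda>m :: int. nat (m\<^sup>2)) + gf {m. odd m} (\<lambda>m :: int. nat (m\<^sup>2))"
    by (rule gf_Un) (auto intro: finite_fibers_square)
  finally show ?thesis by (simp add: gf_even_squares gf_odd_squares)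
qed

lemma dil_1_left: "dil (Suc 0) F = F"
  by (simp add: dil_def)

lemma gf_Times_scaled_squares:
  fixes S T :: "int set"
  assumes "j > 0" "k > 0"
  shows "gf (S \<times> T) (\<lambda>(x, y). j * nat (x\<^sup>2) + k * nat (y\<^sup>2)) =
    dil j (gf S (\<lambda>m. nat (m\<^sup>2))) * dil k (gf T (\<lambda>m. nat (m\<^sup>2)))"
  using assms
  by (simp add: gf_Times finite_fibers_scale finite_fibers_square gf_scale)

lemma finite_fibers_quadratic_form:
  fixes S :: "(int \<times> int) set"
  assumes "j > 0" "k > 0"
  shows "finite_fibers S (\<lambda>(x, y). j * nat (x\<^sup>2) + k * nat (y\<^sup>2))"
proof -
  have "finite_fibers (UNIV \<times> UNIV :: (int \<times> int) set) (\<lambda>(x, y). j * nat (x\<^sup>2) + k * nat (y\<^sup>2))"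
    using assms by (intro finite_fibers_Times finite_fibers_scale finite_fibers_square)
  then show ?thesis by (rule finite_fibers_subset) simp
qed

text \<open>The map \<open>(u, v) \<mapsto> (u + v, u - v)\<close> doubles \<open>u^2 + v^2\<close> and reaches exactly the pairs of equal parity.\<close>

lemma phi_dil2_square: "(dil 2 phi)\<^sup>2 = (dil 4 phi)\<^sup>2 + 4 * fps_X\<^sup>2 * (dil 8 psi)\<^sup>2"
proof -
  let ?w = "\<lambda>(x, y). 1 * nat (x\<^sup>2) + 1 * nat (y\<^sup>2) :: nat"
  have "(dil 2 phi)\<^sup>2 =
      gf (UNIV \<times> UNIV :: (int \<times> int) set) (\<lambda>(x, y). 2 * nat (x\<^sup>2) + 2 * nat (y\<^sup>2))"
    using gf_Times_scaled_squares [of 2 2 UNIV UNIV] by (simp only: phi_def power2_eq_square [of "dil 2 _"] zero_less_numeral simp_thms)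
  also have "\<dots> = gf ({m. even m} \<times> {m. even m} \<union> {m. odd m} \<times> {m. odd m}) ?w"
  proof (rule gf_bij)
    show "bij_betw (\<lambda>(u, v). (u + v, u - v)) (UNIV \<times> UNIV :: (int \<times> int) set)
        ({m. even m} \<times> {m. even m} \<union> {m. odd m} \<times> {m. odd m})"
    proof (rule bij_betwI [where g = "\<lambda>(x, y). ((x + y) div 2, (x - y) div 2)"])
      fix p :: "int \<times> int" assume p: "p \<in> {m. even m} \<times> {m. even m} \<union> {m. odd m} \<times> {m :: int. odd m}"
      obtain x y where "p = (x, y)" by (cases p)
      with p have "even (x + y)" "even (x - y)" by auto
      then have "(x + y) div 2 + (x - y) div 2 = x \<and> (x + y) div 2 - (x - y) div 2 = y"
        by presburger
      then show "(case (case p of (x, y) \<Rightarrow> ((x + y) div 2, (x - y) div 2)) of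
          (u, v) \<Rightarrow> (u + v, u - v)) = p"
        by (simp add: \<open>p = (x, y)\<close>)
    qed auto
  next
    fix p :: "int \<times> int"
    obtain u v where p: "p = (u, v)" by (cases p)
    have "nat ((u + v)\<^sup>2) + nat ((u - v)\<^sup>2) = nat ((u + v)\<^sup>2 + (u - v)\<^sup>2)"
      by (simp add: nat_add_distrib)
    also have "(u + v)\<^sup>2 + (u - v)\<^sup>2 = 2 * u\<^sup>2 + 2 * v\<^sup>2"
      by (simp add: power2_eq_square algebra_simps)
    also have "nat \<dots> = 2 * nat (u\<^sup>2) + 2 * nat (v\<^sup>2)"
      by (simp add: nat_add_distrib nat_mult_distrib)
    finally show "?w (case p of (u, v) \<Rightarrow> (u + v, u - v)) =
        (case p of (x, y) \<Rightarrow> 2 * nat (x\<^sup>2) + 2 * nat (y\<^sup>2))"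
      by (simp add: p)
  qed
  also have "\<dots> = gf ({m. even m} \<times> {m. even m}) ?w + gf ({m. odd m} \<times> {m. odd m}) ?w"
    by (rule gf_Un) (rule finite_fibers_quadratic_form, simp, simp, rule finite_fibers_quadratic_form, auto)
  also have "\<dots> = (dil 4 phi)\<^sup>2 + (2 * fps_X * dil 8 psi)\<^sup>2"
    by (simp only: gf_Times_scaled_squares zero_less_one gf_even_squares gf_odd_squares)
      (simp add: dil_1_left power2_eq_square)
  finally show ?thesis by (simp add: power_mult_distrib)
qed

text \<open>Count the pairs of odd numbers by \<open>u^2 + 3v^2\<close>. Of the two conditions \<open>u \<equiv> v\<close> and \<open>u \<equiv> - v\<close> modulo 4
  exactly one holds, and in either case \<open>(x, y) \<mapsto> (x + 3y, \<plusminus>(x - y))\<close>, which multiplies \<open>x^2 + 3y^2\<close> by 4,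
  parametrises these pairs by the pairs \<open>(x, y)\<close> of different parity.\<close>

lemma psi_psi_dil3: "psi * dil 3 psi = dil 4 psi * dil 6 phi + fps_X * dil 2 phi * dil 12 psi"
proof -
  let ?w = "\<lambda>(x, y). 1 * nat (x\<^sup>2) + 3 * nat (y\<^sup>2) :: nat"
  let ?E = "{m :: int. even m}" and ?O = "{m :: int. odd m}"
  let ?mixed = "?E \<times> ?O \<union> ?O \<times> ?E"
  have div_eq: "(v + 4 * k + 3 * v) div 4 = v + k" for v k :: int
    by simp
  have div_eq': "(x + 3 * y + 3 * (x - y)) div 4 = x" "(x + 3 * y - (x - y)) div 4 = y" for x y :: int
    by simp_all
  have div_eq2: "(4 * k - v - 3 * v) div 4 = k - v" for v k :: int
    by simp
  have div_eq2': "(x + 3 * y - 3 * (y - x)) div 4 = x" "(x + 3 * y + (y - x)) div 4 = y" for x y :: int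
    by simp_all
  have w4: "?w (x + 3 * y, s * (x - y)) = 4 * ?w (x, y)" if "s\<^sup>2 = 1" for x y s :: int
  proof -
    have "?w (x + 3 * y, s * (x - y)) = nat ((x + 3 * y)\<^sup>2 + 3 * (s * (x - y))\<^sup>2)"
      by (simp add: nat_add_distrib nat_mult_distrib)
    also have "(x + 3 * y)\<^sup>2 + 3 * (s * (x - y))\<^sup>2 = 4 * (x\<^sup>2 + 3 * y\<^sup>2)"
      using that by (simp add: power_mult_distrib) (simp add: power2_eq_square algebra_simps)
    also have "nat \<dots> = 4 * ?w (x, y)"
      by (simp add: nat_add_distrib nat_mult_distrib)
    finally show ?thesis .
  qed
  have mixed: "gf ?mixed ?w = dil 4 phi * (2 * fps_X ^ 3 * dil 24 psi) +
      (2 * fps_X * dil 8 psi) * dil 12 phi"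
  proof -
    have "gf ?mixed ?w = gf (?E \<times> ?O) ?w + gf (?O \<times> ?E) ?w"
      by (rule gf_Un) (rule finite_fibers_quadratic_form, simp, simp, rule finite_fibers_quadratic_form, auto)
    then show ?thesis
      by (simp only: gf_Times_scaled_squares zero_less_one zero_less_numeral gf_even_squares gf_odd_squares)
        (simp add: dil_simps dil_dil dil_1_left)
  qed
  have "4 * fps_X ^ 4 * dil 8 psi * dil 24 psi = gf (?O \<times> ?O) ?w"
    by (simp only: gf_Times_scaled_squares zero_less_one zero_less_numeral gf_even_squares gf_odd_squares)
      (simp add: dil_simps dil_dil dil_1_left eval_nat_numeral mult.assoc mult.left_commute)
  also have "?O \<times> ?O = {(u, v). odd u \<and> odd v \<and> 4 dvd u - v} \<union> {(u, v). odd u \<and> odd v \<and> 4 dvd u + v}"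
    (is "_ = ?P \<union> ?Q")
  proof -
    have "4 dvd u - v \<or> 4 dvd u + v" if "odd u" "odd v" for u v :: int
      using that by presburger
    then show ?thesis by auto
  qed
  also have "gf (?P \<union> ?Q) ?w = gf ?P ?w + gf ?Q ?w"
  proof (rule gf_Un)
    have "\<not> (4 dvd u - v \<and> 4 dvd u + v)" if "odd u" "odd v" for u v :: int
      using that by presburger
    then show "?P \<inter> ?Q = {}" by auto
    show "finite_fibers ?P ?w" "finite_fibers ?Q ?w"
      by (rule finite_fibers_quadratic_form; simp)+
  qed
  also have "gf ?P ?w = gf ?mixed (\<lambda>p. 4 * ?w p)"
  proof (rule gf_bij [symmetric])
    show "bij_betw (\<lambda>(x, y). (x + 3 * y, 1 * (x - y))) ?mixed ?P"
    proof (rule bij_betwI [where g = "\<lambda>(u, v). ((u + 3 * v) div 4, (u - v) div 4)"])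
      have P: "\<exists>v k. p = (v + 4 * k, v) \<and> odd v" if "p \<in> ?P" for p
      proof -
        obtain u v where p: "p = (u, v)" by (cases p)
        with that obtain k where "u - v = 4 * k" "odd v" by (auto elim: dvdE)
        then have "p = (v + 4 * k, v) \<and> odd v" by (simp add: p)
        then show ?thesis by blast
      qed
      show "(\<lambda>(u, v). ((u + 3 * v) div 4, (u - v) div 4)) \<in> ?P \<rightarrow> ?mixed"
        by (rule Pi_I, drule P) (auto simp: div_eq)
      show "(case (case p of (u, v) \<Rightarrow> ((u + 3 * v) div 4, (u - v) div 4)) of
          (x, y) \<Rightarrow> (x + 3 * y, 1 * (x - y))) = p" if "p \<in> ?P" for p
        using P [OF that] by (auto simp: div_eq)
    qed (auto simp: div_eq')
    show "?w (case p of (x, y) \<Rightarrow> (x + 3 * y, 1 * (x - y))) = 4 * ?w p" for p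
      using w4 [of 1 "fst p" "snd p"] by (simp only: case_prod_beta fst_conv snd_conv power_one)
  qed
  also have "gf ?Q ?w = gf ?mixed (\<lambda>p. 4 * ?w p)"
  proof (rule gf_bij [symmetric])
    show "bij_betw (\<lambda>(x, y). (x + 3 * y, (- 1) * (x - y))) ?mixed ?Q"
    proof (rule bij_betwI [where g = "\<lambda>(u, v). ((u - 3 * v) div 4, (u + v) div 4)"])
      have Q: "\<exists>v k. p = (4 * k - v, v) \<and> odd v" if "p \<in> ?Q" for p
      proof -
        obtain u v where p: "p = (u, v)" by (cases p)
        with that obtain k where "u + v = 4 * k" "odd v" by (auto elim: dvdE)
        then have "p = (4 * k - v, v) \<and> odd v" by (simp add: p)
        then show ?thesis by blast
      qed
      show "(\<lambda>(u, v). ((u - 3 * v) div 4, (u + v) div 4)) \<in> ?Q \<rightarrow> ?mixed"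
        by (rule Pi_I, drule Q) (auto simp: div_eq2)
      show "(case (case p of (u, v) \<Rightarrow> ((u - 3 * v) div 4, (u + v) div 4)) of
          (x, y) \<Rightarrow> (x + 3 * y, (- 1) * (x - y))) = p" if "p \<in> ?Q" for p
        using Q [OF that] by (auto simp: div_eq2)
    qed (auto simp: div_eq2')
    show "?w (case p of (x, y) \<Rightarrow> (x + 3 * y, (- 1) * (x - y))) = 4 * ?w p" for p
      using w4 [of "- 1" "fst p" "snd p"]
      by (simp only: case_prod_beta fst_conv snd_conv power2_minus power_one)
  qed
  also have "gf ?mixed (\<lambda>p. 4 * ?w p) + gf ?mixed (\<lambda>p. 4 * ?w p) = 2 * dil 4 (gf ?mixed ?w)"
    by (simp add: gf_scale)
  also have "\<dots> = 4 * fps_X ^ 4 * dil 8 (dil 4 psi * dil 6 phi + fps_X * dil 2 phi * dil 12 psi)"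
    by (simp only: mixed) (simp add: dil_simps dil_dil algebra_simps flip: power_mult power_add)
  finally have "4 * fps_X ^ 4 * dil 8 (psi * dil 3 psi) =
      4 * fps_X ^ 4 * dil 8 (dil 4 psi * dil 6 phi + fps_X * dil 2 phi * dil 12 psi)"
    by (simp add: dil_mult dil_dil mult.assoc)
  then show ?thesis by (simp add: dil_inject)
qed

lemma phi_nth_0 [simp]: "phi $ 0 = 1"
proof -
  have "{m :: int. nat (m\<^sup>2) = 0} = {0}" by auto
  then show ?thesis by (simp add: phi_def gf_nth)
qed

lemma psi_nth_0 [simp]: "psi $ 0 = 1"
proof -
  have "n * (n + 1) div 2 = 0 \<longleftrightarrow> n = 0" for n :: nat
  proof
    assume "n * (n + 1) div 2 = 0"
    then have "n * (n + 1) < 2" by linarith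
    then show "n = 0" by (cases n) auto
  qed simp
  then have "{n :: nat. n * (n + 1) div 2 = 0} = {0}"
    by (simp only: singleton_conv)
  then show ?thesis by (simp only: psi_def gf_nth) simp
qed

lemma dil_nth_0 [simp]: "k > 0 \<Longrightarrow> dil k F $ 0 = F $ 0"
  by (simp add: dil_nth)

lemma fps_nonzero_if_nth: "F $ n \<noteq> 0 \<Longrightarrow> F \<noteq> (0 :: int fps)"
  by auto

lemma fps_cancel_left: "K * F = K * G \<Longrightarrow> K \<noteq> 0 \<Longrightarrow> F = (G :: int fps)"
  by simp

lemma alt_nth_0 [simp]: "alt F $ 0 = F $ 0"
  by (simp add: alt_nth)

lemma phi_square: "phi\<^sup>2 = (dil 2 phi)\<^sup>2 + 4 * fps_X * (dil 4 psi)\<^sup>2"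
proof -
  have "dil 2 ((dil 2 phi)\<^sup>2 + 4 * fps_X * (dil 4 psi)\<^sup>2) =
      (dil 4 phi)\<^sup>2 + 4 * fps_X\<^sup>2 * (dil 8 psi)\<^sup>2"
    by (simp add: dil_simps dil_dil)
  also have "\<dots> = dil 2 (phi\<^sup>2)"
    by (simp only: phi_dil2_square dil_power zero_less_numeral)
  finally show ?thesis by (simp add: dil_inject)
qed

lemma alt_phi_split: "alt phi = dil 4 phi - 2 * fps_X * dil 8 psi"
  by (subst phi_split) (simp add: alt_simps alt_dil_even)

lemma alt_phi_square: "(alt phi)\<^sup>2 = (dil 2 phi)\<^sup>2 - 4 * fps_X * (dil 4 psi)\<^sup>2"
  using arg_cong [OF phi_square, of alt] by (simp add: alt_simps alt_dil_even)

lemma phi_mult_alt_phi: "phi * alt phi = (dil 2 (alt phi))\<^sup>2"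
proof -
  have "phi * alt phi = (dil 4 phi)\<^sup>2 - 4 * fps_X\<^sup>2 * (dil 8 psi)\<^sup>2"
    by (subst phi_split, subst alt_phi_split) (simp add: power2_eq_square algebra_simps)
  also have "\<dots> = dil 2 ((alt phi)\<^sup>2)"
    by (simp add: alt_phi_square dil_simps dil_dil)
  finally show ?thesis by (simp add: dil_power)
qed

text \<open>The odd part of \<open>\<phi>(q)^2\<close>, computed once from the dissection of \<open>\<phi>(q)\<close> and once from that of \<open>\<phi>(q)^2\<close>.\<close>

lemma psi_square: "psi\<^sup>2 = phi * dil 2 psi"
proof -
  have "phi\<^sup>2 = (dil 4 phi + 2 * fps_X * dil 8 psi)\<^sup>2"
    using phi_split by simp
  moreover note phi_square phi_dil2_square
  ultimately have "4 * fps_X * (dil 4 psi)\<^sup>2 = 4 * fps_X * (dil 4 phi * dil 8 psi)"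
    by (simp add: power2_sum power_mult_distrib)
  then have "dil 4 (psi\<^sup>2) = dil 4 (phi * dil 2 psi)"
    by (simp add: dil_simps dil_dil)
  then show ?thesis by (simp add: dil_inject)
qed

lemma alt_psi_square: "(alt psi)\<^sup>2 = alt phi * dil 2 psi"
  using arg_cong [OF psi_square, of alt] by (simp add: alt_simps alt_dil_even)

text \<open>The squares agree by the formulas for \<open>\<psi>(q)^2\<close> and \<open>\<phi>(q)\<phi>(-q)\<close>.\<close>

lemma psi_mult_alt_psi: "psi * alt psi = dil 2 psi * dil 2 (alt phi)"
proof (rule fps_square_eq_imp_eq)
  show "(psi * alt psi)\<^sup>2 = (dil 2 psi * dil 2 (alt phi))\<^sup>2"
    by (simp add: power_mult_distrib psi_square alt_psi_square phi_mult_alt_phi [symmetric])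
      (simp add: power2_eq_square)
qed simp_all

text \<open>Factor the difference as \<open>(\<phi>(q)^2 - \<phi>(-q)^2)(\<phi>(q)^2 + \<phi>(-q)^2)\<close>, which is \<open>8q \<psi>(q^4)^2 \<sqdot> 2 \<phi>(q^2)^2\<close>.\<close>

lemma jacobi_quartic: "phi ^ 4 - alt phi ^ 4 = 16 * fps_X * dil 2 psi ^ 4"
proof -
  have "dil 2 (psi\<^sup>2) = dil 2 phi * dil 4 psi"
    by (simp add: psi_square dil_simps dil_dil)
  then have *: "(dil 2 psi)\<^sup>2 = dil 2 phi * dil 4 psi" by (simp add: dil_power)
  have "phi ^ 4 - alt phi ^ 4 = (phi\<^sup>2)\<^sup>2 - ((alt phi)\<^sup>2)\<^sup>2" by simp
  also have "\<dots> = 16 * fps_X * (dil 2 phi * dil 4 psi)\<^sup>2"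
    unfolding phi_square alt_phi_square by (simp add: power2_eq_square algebra_simps)
  also have "\<dots> = 16 * fps_X * dil 2 psi ^ 4"
    by (simp flip: * power_mult)
  finally show ?thesis .
qed

text \<open>The modular equation of degree 3. Its left side is twice the odd part of \<open>\<phi>(q)\<phi>(q^3)\<close>.\<close>

lemma modular_equation_3:
  "phi * dil 3 phi - alt phi * dil 3 (alt phi) = 4 * fps_X * dil 2 psi * dil 6 psi"
proof -
  have 3: "dil 3 phi = dil 12 phi + 2 * fps_X ^ 3 * dil 24 psi"
    using arg_cong [OF phi_split, of "dil 3"] by (simp add: dil_simps dil_dil)
  have alt3: "dil 3 (alt phi) = dil 12 phi - 2 * fps_X ^ 3 * dil 24 psi"
    by (simp add: alt_phi_split dil_simps dil_dil)
  have *: "dil 2 psi * dil 6 psi = dil 8 psi * dil 12 phi + fps_X\<^sup>2 * dil 4 phi * dil 24 psi"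
    using arg_cong [OF psi_psi_dil3, of "dil 2"] by (simp add: dil_simps dil_dil)
  show ?thesis
    unfolding 3 alt3
    by (subst phi_split, subst alt_phi_split, unfold mult.assoc *)
      (simp add: algebra_simps power2_eq_square power3_eq_cube)
qed

section \<open>The differential equation of the theta functions\<close>

text \<open>Compare lowest coefficients: if \<open>F\<close> begins with \<open>q^n\<close>, \<open>n > 0\<close>, then \<open>F(q^2)\<close> begins only with \<open>q^(2n)\<close>.\<close>

lemma fps_eq_0_if_dil2:
  fixes F G H :: "int fps"
  assumes "F * G = dil 2 F * H" "G $ 0 \<noteq> 0" "F $ 0 = 0"
  shows "F = 0"
proof (rule ccontr)
  assume "F \<noteq> 0"
  define n where "n = subdegree F"
  have Fn: "F $ n \<noteq> 0" using \<open>F \<noteq> 0\<close> by (simp add: n_def)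
  then have "n > 0" using assms(3) by (cases n) auto
  have F0: "F $ i = 0" if "i < n" for i
    using that by (simp add: n_def nth_less_subdegree_zero)
  have "(F * G) $ n = F $ n * G $ 0"
  proof -
    have "(F * G) $ n = (\<Sum>i\<in>{n}. F $ i * G $ (n - i))"
      unfolding fps_mult_nth by (intro sum.mono_neutral_right) (auto simp: F0)
    then show ?thesis by simp
  qed
  moreover have "(dil 2 F * H) $ n = 0"
    unfolding fps_mult_nth
  proof (intro sum.neutral ballI)
    fix i assume "i \<in> {0..n}"
    then have "i div 2 < n" using \<open>n > 0\<close> by auto
    then show "dil 2 F $ i * H $ (n - i) = 0" by (simp add: dil_nth F0)
  qed
  ultimately show False using assms Fn by simp
qed

text \<open>In terms of \<open>U = q^(1/4) \<psi>(q^2)/\<phi>(q)\<close> this is \<open>4 \<Theta> log U = \<phi>(-q)^4\<close>, which is equivalent to Jacobi's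
  four-square theorem. With \<open>a = \<phi>(q)\<close>, \<open>b = \<psi>(q^2)\<close>, \<open>e = \<phi>(-q)\<close>, both sides \<open>F\<close> satisfy
  \<open>a b F(q) = e^2 F(q^2)\<close>: this follows from the formulas that express \<open>a^2\<close>, \<open>b^2\<close> and \<open>e^2\<close> through the
  values of \<open>a\<close> and \<open>b\<close> at \<open>q^2\<close>, and from their derivatives. So does the difference of the two sides, which
  has no constant coefficient and must therefore vanish.\<close>

lemma theta_wronskian:
  "4 * (phi * qderiv (dil 2 psi) - dil 2 psi * qderiv phi) + phi * dil 2 psi =
    phi * dil 2 psi * alt phi ^ 4"
proof -
  define a b e where "a = phi" and "b = dil 2 psi" and "e = alt phi"
  define a2 b2 where "a2 = dil 2 phi" and "b2 = dil 4 psi"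
  define D where "D = 4 * (a * qderiv b - b * qderiv a) + a * b"
  define X :: "int fps" where "X = fps_X"
  have dX: "qderiv X = X" by (simp add: X_def qderiv_X)
  have a: "a * a = a2 * a2 + 4 * X * b2 * b2"
    using phi_square by (simp add: a_def a2_def b2_def X_def power2_eq_square mult.assoc)
  have e: "e * e = a2 * a2 - 4 * X * b2 * b2"
    using alt_phi_square by (simp add: e_def a2_def b2_def X_def power2_eq_square mult.assoc)
  have b: "b * b = a2 * b2"
    using arg_cong [OF psi_square, of "dil 2"]
    by (simp add: b_def a2_def b2_def dil_simps dil_dil power2_eq_square)
  have ae: "dil 2 e * dil 2 e = a * e"
    using phi_mult_alt_phi by (simp add: a_def e_def power2_eq_square)
  have da: "2 * a * qderiv a = 2 * a2 * qderiv a2 + 4 * X * b2 * b2 + 8 * X * b2 * qderiv b2"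
    using arg_cong [OF a, of qderiv] by (simp add: qderiv_simps dX algebra_simps)
  have db: "2 * b * qderiv b = a2 * qderiv b2 + b2 * qderiv a2"
    using arg_cong [OF b, of qderiv] by (simp add: qderiv_simps algebra_simps)
  have dil_a: "dil 2 a = a2" "dil 2 b = b2" "dil 2 (qderiv a) * 2 = qderiv a2" "dil 2 (qderiv b) * 2 = qderiv b2"
    by (simp_all add: a_def b_def a2_def b2_def dil_dil qderiv_dil dil_mult dil_numeral)
  have D2: "dil 2 D = 2 * (a2 * qderiv b2 - b2 * qderiv a2) + a2 * b2"
    unfolding D_def by (simp add: dil_simps dil_a flip: dil_a(3,4))
  have key: "a * b * D = e * e * dil 2 D"
  proof -
    have "a * b * D = 2 * (a * a) * (2 * b * qderiv b) - 2 * (b * b) * (2 * a * qderiv a) + (a * a) * (b * b)"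
      by (simp add: D_def algebra_simps)
    also have "\<dots> = e * e * dil 2 D"
      unfolding da db unfolding a b e D2 by (simp add: algebra_simps)
    finally show ?thesis .
  qed
  have key2: "a * b * (a * b * e ^ 4) = e * e * dil 2 (a * b * e ^ 4)"
  proof -
    have "dil 2 (a * b * e ^ 4) = (a2 * b2) * (dil 2 e * dil 2 e)\<^sup>2"
      by (simp only: dil_mult dil_power dil_a zero_less_numeral) (simp add: eval_nat_numeral mult.assoc)
    also have "\<dots> = b * b * (a * e)\<^sup>2" by (simp only: ae b)
    finally show ?thesis by (simp add: eval_nat_numeral algebra_simps)
  qed
  define F where "F = D - a * b * e ^ 4"
  have "F = 0"
  proof (rule fps_eq_0_if_dil2)
    show "F * (a * b) = dil 2 F * (e * e)"
      using key key2 by (simp add: F_def dil_diff algebra_simps)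
    show "F $ 0 = 0"
      by (simp add: F_def D_def a_def b_def e_def qderiv_nth fps_nth_power_0)
  qed (simp_all add: a_def b_def e_def)
  then show ?thesis by (simp add: F_def D_def a_def b_def e_def)
qed

text \<open>The logarithmic derivative of \<open>\<phi>(-q)/\<phi>(q)\<close>, obtained by differentiating the quartic relation.\<close>

lemma alt_phi_qderiv:
  "phi * qderiv (alt phi) - alt phi * qderiv phi = - 4 * fps_X * phi * dil 2 psi ^ 4 * alt phi"
proof -
  define a b e where "a = phi" and "b = dil 2 psi" and "e = alt phi"
  define X :: "int fps" where "X = fps_X"
  have dX: "qderiv X = X" by (simp add: X_def qderiv_X)
  have quartic: "e ^ 4 = a ^ 4 - 16 * X * b ^ 4"
    using jacobi_quartic by (simp add: a_def b_def e_def X_def algebra_simps)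
  have W: "4 * (a * qderiv b - b * qderiv a) + a * b = a * b * e ^ 4"
    using theta_wronskian by (simp add: a_def b_def e_def)
  have "4 * e ^ 3 * qderiv e = 4 * a ^ 3 * qderiv a - 16 * X * b ^ 4 - 64 * X * b ^ 3 * qderiv b"
    using arg_cong [OF quartic, of qderiv] by (simp add: qderiv_simps dX algebra_simps)
  then have "a * (4 * e ^ 3 * qderiv e) =
      a * (4 * a ^ 3 * qderiv a - 16 * X * b ^ 4 - 64 * X * b ^ 3 * qderiv b)"
    by (rule arg_cong)
  then have "4 * a * (e ^ 3 * qderiv e) = 4 * (a ^ 4 - 16 * X * b ^ 4) * qderiv a -
      16 * X * b ^ 3 * (4 * (a * qderiv b - b * qderiv a) + a * b)"
    by (simp add: algebra_simps eval_nat_numeral)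
  then have "4 * e ^ 3 * (a * qderiv e - e * qderiv a + 4 * X * a * b ^ 4 * e) = 0"
    unfolding W quartic [symmetric] by (simp add: algebra_simps eval_nat_numeral)
  moreover have "e ^ 3 \<noteq> 0"
    by (rule fps_nonzero_if_nth_0) (simp add: e_def fps_nth_power_0)
  ultimately have "a * qderiv e - e * qderiv a + 4 * X * a * b ^ 4 * e = 0"
    by simp
  then show ?thesis by (simp add: a_def b_def e_def X_def algebra_simps)
qed

section \<open>Exactness modulo 5\<close>

definition mod5_exact :: "int fps \<Rightarrow> bool" where
  "mod5_exact F \<longleftrightarrow> (\<exists>Z. 5 dvd F - qderiv Z)"

lemma five_dvd_fps_nth:
  assumes "(5 :: int fps) dvd F"
  shows "5 dvd F $ n"
proof -
  obtain G where "F = 5 * G" using assms by (rule dvdE)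
  then have "F $ n = 5 * G $ n"
    by (simp add: numeral_fps_const)
  then show ?thesis by simp
qed

lemma mod5_exact_nth:
  assumes "mod5_exact F" "5 dvd n"
  shows "5 dvd F $ n"
proof -
  obtain Z where "5 dvd F - qderiv Z" using assms(1) by (auto simp: mod5_exact_def)
  then have "5 dvd (F - qderiv Z) $ n" by (rule five_dvd_fps_nth)
  moreover have "5 dvd qderiv Z $ n"
    using assms(2) by (auto simp: qderiv_nth elim!: dvdE)
  ultimately have "5 dvd (F - qderiv Z) $ n + qderiv Z $ n" by (rule dvd_add)
  then show ?thesis by simp
qed

lemma mod5_exact_qderiv: "mod5_exact (qderiv Z)"
  unfolding mod5_exact_def by (rule exI [of _ Z]) simp

lemma mod5_exact_cong:
  assumes "mod5_exact F" "5 dvd G - F"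
  shows "mod5_exact G"
proof -
  obtain Z where "5 dvd F - qderiv Z" using assms(1) by (auto simp: mod5_exact_def)
  from dvd_add [OF assms(2) this] show ?thesis
    unfolding mod5_exact_def by (intro exI [of _ Z]) simp
qed

lemma mod5_exact_add:
  assumes "mod5_exact F" "mod5_exact G"
  shows "mod5_exact (F + G)"
proof -
  obtain Y Z where "5 dvd F - qderiv Y" "5 dvd G - qderiv Z"
    using assms by (auto simp: mod5_exact_def)
  then have "5 dvd (F - qderiv Y) + (G - qderiv Z)" by (rule dvd_add)
  then show ?thesis
    unfolding mod5_exact_def by (intro exI [of _ "Y + Z"]) (simp add: qderiv_add algebra_simps)
qed

text \<open>\<open>\<Theta>(G^5 Z) = G^5 \<Theta>Z + 5 G^4 Z \<Theta>G\<close>: fifth powers are constants for \<open>\<Theta>\<close> modulo 5.\<close>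

lemma mod5_exact_fifth_power_mult:
  assumes "mod5_exact F"
  shows "mod5_exact (G ^ 5 * F)"
proof -
  obtain Z where "5 dvd F - qderiv Z" using assms by (auto simp: mod5_exact_def)
  then have "5 dvd G ^ 5 * (F - qderiv Z)" by (rule dvd_mult)
  then have "5 dvd G ^ 5 * (F - qderiv Z) - 5 * (G ^ 4 * qderiv G * Z)"
    by (rule dvd_diff) (rule dvd_triv_left)
  then show ?thesis
    unfolding mod5_exact_def
    by (intro exI [of _ "G ^ 5 * Z"]) (simp add: qderiv_mult qderiv_power algebra_simps)
qed

lemma mod5_exact_0: "5 dvd F \<Longrightarrow> mod5_exact F"
  unfolding mod5_exact_def by (rule exI [of _ 0]) (simp add: qderiv_def)

lemma mod5_exact_numeral_mult: "mod5_exact F \<Longrightarrow> mod5_exact (of_int k * F)"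
proof -
  assume "mod5_exact F"
  then obtain Z where "5 dvd F - qderiv Z" by (auto simp: mod5_exact_def)
  then have "5 dvd of_int k * (F - qderiv Z)" by (rule dvd_mult)
  moreover have "qderiv (of_int k * Z) = of_int k * qderiv Z"
    by (simp add: qderiv_def algebra_simps)
  ultimately show ?thesis
    unfolding mod5_exact_def by (intro exI [of _ "of_int k * Z"]) (simp add: algebra_simps)
qed

lemma mod5_exact_fifth_power_cancel:
  assumes "mod5_exact (G ^ 5 * F)" "G $ 0 = 1"
  shows "mod5_exact F"
proof -
  obtain H where "G * H = 1" using fps_unit_inverse [OF assms(2)] by blast
  have "H ^ 5 * (G ^ 5 * F) = (G * H) ^ 5 * F"
    by (simp only: power_mult_distrib ac_simps)
  then have "H ^ 5 * (G ^ 5 * F) = F"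
    using \<open>G * H = 1\<close> by simp
  with mod5_exact_fifth_power_mult [OF assms(1), of H] show ?thesis by simp
qed

lemma mod5_exact_unit_cancel:
  assumes "mod5_exact (of_int k * F)" "j * k mod 5 = 1"
  shows "mod5_exact F"
proof -
  have "mod5_exact (of_int j * (of_int k * F))"
    using assms(1) by (rule mod5_exact_numeral_mult)
  moreover have "5 dvd F - of_int j * (of_int k * F)"
  proof -
    have "j * k = 5 * (j * k div 5) + 1" using assms(2) by presburger
    then have "of_int j * of_int k = (5 * of_int (j * k div 5) + 1 :: int fps)"
      by (metis of_int_1 of_int_add of_int_mult of_int_numeral)
    then have "F - of_int j * (of_int k * F) = 5 * (- of_int (j * k div 5) * F)"
      by (simp add: algebra_simps flip: mult.assoc)
    then show ?thesis by simp
  qed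
  ultimately show ?thesis by (rule mod5_exact_cong)
qed

text \<open>With \<open>x = A/C\<close> this is \<open>C^25 x^i \<Theta>x\<close>, and \<open>C^25\<close> is a constant modulo 5. The primitive
  \<open>C^25 x^(i+1)/(i+1)\<close> exists modulo 5 because 5 does not divide \<open>i + 1\<close>.\<close>

lemma mod5_exact_monomial:
  assumes "i \<le> 21" "i mod 5 \<noteq> 4"
  shows "mod5_exact (A ^ i * C ^ (23 - i) * (C * qderiv A - A * qderiv C))"
proof -
  define k where "k = 23 - i"
  have k: "24 - i = Suc k" "int k = 23 - int i" using assms(1) by (simp_all add: k_def of_nat_diff)
  have of_k: "of_nat (Suc k) = (24 - of_nat i :: int fps)"
    using assms(1) by (simp add: k_def of_nat_diff)
  have "qderiv (A ^ Suc i * C ^ Suc k) =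
      of_nat (Suc i) * A ^ i * C ^ Suc k * qderiv A + of_nat (Suc k) * A ^ Suc i * C ^ k * qderiv C"
    by (simp only: qderiv_mult qderiv_power diff_Suc_1) (simp only: ac_simps)
  also have "\<dots> = of_nat (Suc i) * (A ^ i * C ^ k * (C * qderiv A - A * qderiv C)) +
      5 * (5 * (A ^ Suc i * C ^ k * qderiv C))"
    unfolding of_k by (simp add: algebra_simps)
  finally have eq: "of_int (int (Suc i)) * (A ^ i * C ^ k * (C * qderiv A - A * qderiv C)) -
      qderiv (A ^ Suc i * C ^ Suc k) = 5 * (- 5 * (A ^ Suc i * C ^ k * qderiv C))"
    by simp
  have "mod5_exact (of_int (int (Suc i)) * (A ^ i * C ^ k * (C * qderiv A - A * qderiv C)))"
    by (rule mod5_exact_cong [OF mod5_exact_qderiv]) (subst eq, rule dvd_triv_left)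
  moreover have "\<exists>j. j * int (Suc i) mod 5 = 1"
  proof -
    have "coprime (int (Suc i)) 5"
    proof -
      have "\<not> 5 dvd int (Suc i)" using assms(2) by presburger
      then show ?thesis
        using prime_imp_coprime [of 5 "int (Suc i)"] by (simp add: coprime_commute)
    qed
    then show ?thesis
      using cong_solve_coprime_int [of "int (Suc i)" 5] by (auto simp: cong_def mult.commute)
  qed
  ultimately have "mod5_exact (A ^ i * C ^ k * (C * qderiv A - A * qderiv C))"
    by (elim exE) (rule mod5_exact_unit_cancel)
  then show ?thesis by (simp only: k_def)
qed

lemma mod5_exact_sum_monomials:
  fixes A C :: "int fps" and r :: "nat \<Rightarrow> int"
  assumes "\<And>i. i \<le> 21 \<Longrightarrow> i mod 5 = 4 \<Longrightarrow> 5 dvd r i"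
  shows "mod5_exact (\<Sum>i\<le>21. of_int (r i) * (A ^ i * C ^ (23 - i) * (C * qderiv A - A * qderiv C)))"
proof -
  have "mod5_exact (\<Sum>i\<in>I. of_int (r i) * (A ^ i * C ^ (23 - i) * (C * qderiv A - A * qderiv C)))"
    if "finite I" "I \<subseteq> {..21}" for I
    using that
  proof (induction I rule: finite_induct)
    case empty
    show ?case by (simp add: mod5_exact_0)
  next
    case (insert i I)
    have "mod5_exact (of_int (r i) * (A ^ i * C ^ (23 - i) * (C * qderiv A - A * qderiv C)))"
    proof (cases "i mod 5 = 4")
      case True
      with insert.prems assms have "5 dvd r i" by auto
      then obtain s where "r i = 5 * s" by blast
      then have "5 dvd (of_int (r i) :: int fps)" by simp
      then show ?thesis by (intro mod5_exact_0 dvd_mult2)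
    next
      case False
      have "i \<le> 21" using insert.prems by simp
      from mod5_exact_monomial [OF this False] show ?thesis
        by (rule mod5_exact_numeral_mult)
    qed
    with insert show ?case by (simp add: mod5_exact_add)
  qed
  then show ?thesis by simp
qed

text \<open>The polynomial \<open>R\<close> behind the theorem, in homogeneous form. Only four of its 22 coefficients have to be
  divisible by 5, namely those of \<open>A^4\<close>, \<open>A^9\<close>, \<open>A^14\<close> and \<open>A^19\<close>.\<close>

lemma mod5_exact_polynomial:
  fixes A C :: "int fps"
  defines "W \<equiv> C * qderiv A - A * qderiv C" and "j \<equiv> A\<^sup>2 + 6 * A * C - 3 * C\<^sup>2"
  shows "mod5_exact (C\<^sup>2 * ((A + C) ^ 4 * (3 * C - A) ^ 3 * (A - C)\<^sup>2 *
    (- (2 ^ 20) * A ^ 8 * C\<^sup>2 * j - 2 ^ 12 * A ^ 4 * C\<^sup>2 * ((A - C) * (A + 3 * C) ^ 5) +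
      2 ^ 12 * A ^ 5 * C * ((A - C)\<^sup>2 * (A + 3 * C) ^ 4) + 4 * j * ((A - C)\<^sup>2 * (A + 3 * C) ^ 8))) * W)"
proof -
  \<comment> \<open>coefficient of \<open>A ^ i\<close> in the expanded product, computed in the identities 1 and 2\<close>
  define r :: "nat \<Rightarrow> int" where "r i = [- 2125764, 708588, 14644152, 2047032, - 10103940, 37310220, - 22184928, - 154003680,
    88137720, 126088920, - 373367088, 95303376, 650474584, - 193036936, - 448255200,
    123007008, 103678028, - 38464324, - 893384, 1039800, - 4180, - 4] ! i" for i
  have 1: "- (2 ^ 20) * A ^ 8 * C\<^sup>2 * j - 2 ^ 12 * A ^ 4 * C\<^sup>2 * ((A - C) * (A + 3 * C) ^ 5) +
      2 ^ 12 * A ^ 5 * C * ((A - C)\<^sup>2 * (A + 3 * C) ^ 4) + 4 * j * ((A - C)\<^sup>2 * (A + 3 * C) ^ 8) =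
      - 78732 * C ^ 12 + 104976 * A * C ^ 11 + 227448 * A ^ 2 * C ^ 10 - 58320 * A ^ 3 * C ^ 9
      + 743580 * A ^ 4 * C ^ 8 + 883872 * A ^ 5 * C ^ 7 - 722736 * A ^ 6 * C ^ 6
      - 996768 * A ^ 7 * C ^ 5 + 2921580 * A ^ 8 * C ^ 4 - 6213040 * A ^ 9 * C ^ 3
      - 1010376 * A ^ 10 * C ^ 2 + 4208 * A ^ 11 * C + 4 * A ^ 12"
    unfolding j_def by algebra
  have 2: "(A + C) ^ 4 * (3 * C - A) ^ 3 * (A - C)\<^sup>2 * (- 78732 * C ^ 12 + 104976 * A * C ^ 11 + 227448 * A ^ 2 * C ^ 10 - 58320 * A ^ 3 * C ^ 9
      + 743580 * A ^ 4 * C ^ 8 + 883872 * A ^ 5 * C ^ 7 - 722736 * A ^ 6 * C ^ 6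
      - 996768 * A ^ 7 * C ^ 5 + 2921580 * A ^ 8 * C ^ 4 - 6213040 * A ^ 9 * C ^ 3
      - 1010376 * A ^ 10 * C ^ 2 + 4208 * A ^ 11 * C + 4 * A ^ 12) =
      - 2125764 * C ^ 21 + 708588 * A * C ^ 20 + 14644152 * A ^ 2 * C ^ 19 + 2047032 * A ^ 3 * C ^ 18
      - 10103940 * A ^ 4 * C ^ 17 + 37310220 * A ^ 5 * C ^ 16 - 22184928 * A ^ 6 * C ^ 15
      - 154003680 * A ^ 7 * C ^ 14 + 88137720 * A ^ 8 * C ^ 13 + 126088920 * A ^ 9 * C ^ 12
      - 373367088 * A ^ 10 * C ^ 11 + 95303376 * A ^ 11 * C ^ 10 + 650474584 * A ^ 12 * C ^ 9
      - 193036936 * A ^ 13 * C ^ 8 - 448255200 * A ^ 14 * C ^ 7 + 123007008 * A ^ 15 * C ^ 6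
      + 103678028 * A ^ 16 * C ^ 5 - 38464324 * A ^ 17 * C ^ 4 - 893384 * A ^ 18 * C ^ 3
      + 1039800 * A ^ 19 * C ^ 2 - 4180 * A ^ 20 * C - 4 * A ^ 21"
    by algebra
  have sum: "(\<Sum>i\<le>21. of_int (r i) * (A ^ i * C ^ (23 - i) * W)) = C\<^sup>2 * (- 2125764 * C ^ 21 + 708588 * A * C ^ 20 + 14644152 * A ^ 2 * C ^ 19 + 2047032 * A ^ 3 * C ^ 18
      - 10103940 * A ^ 4 * C ^ 17 + 37310220 * A ^ 5 * C ^ 16 - 22184928 * A ^ 6 * C ^ 15
      - 154003680 * A ^ 7 * C ^ 14 + 88137720 * A ^ 8 * C ^ 13 + 126088920 * A ^ 9 * C ^ 12
      - 373367088 * A ^ 10 * C ^ 11 + 95303376 * A ^ 11 * C ^ 10 + 650474584 * A ^ 12 * C ^ 9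
      - 193036936 * A ^ 13 * C ^ 8 - 448255200 * A ^ 14 * C ^ 7 + 123007008 * A ^ 15 * C ^ 6
      + 103678028 * A ^ 16 * C ^ 5 - 38464324 * A ^ 17 * C ^ 4 - 893384 * A ^ 18 * C ^ 3
      + 1039800 * A ^ 19 * C ^ 2 - 4180 * A ^ 20 * C - 4 * A ^ 21) * W"
    by (simp add: r_def atMost_nat_numeral eval_nat_numeral algebra_simps)
  have "5 dvd r i" if "i \<le> 21" "i mod 5 = 4" for i
  proof -
    have "i \<in> {4, 9, 14, 19}" using that by simp presburger
    then show ?thesis by (auto simp: r_def)
  qed
  then have "mod5_exact (\<Sum>i\<le>21. of_int (r i) * (A ^ i * C ^ (23 - i) * W))"
    unfolding W_def by (rule mod5_exact_sum_monomials)
  then show ?thesis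
    unfolding 1 2 sum .
qed

section \<open>Relations of degree three\<close>

text \<open>The relations among \<open>a = \<phi>(q)\<close>, \<open>b = \<psi>(q^2)\<close>, \<open>e = \<phi>(-q)\<close> and their values \<open>c\<close>, \<open>d\<close>, \<open>g\<close> at \<open>q^3\<close>. The goal
  is to express them through \<open>a^2\<close> and \<open>c^2\<close>.\<close>

context
  fixes a b c d e g X :: "int fps"
  defines "a \<equiv> phi" and "b \<equiv> dil 2 psi" and "c \<equiv> dil 3 phi" and "d \<equiv> dil 6 psi"
    and "e \<equiv> alt phi" and "g \<equiv> dil 3 (alt phi)" and "X \<equiv> fps_X"
begin

private lemma nth_0 [simp]: "a $ 0 = 1" "b $ 0 = 1" "c $ 0 = 1" "d $ 0 = 1" "e $ 0 = 1" "g $ 0 = 1" "X $ 0 = 0"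
  by (simp_all add: a_def b_def c_def d_def e_def g_def X_def)

private lemma nonzero [simp]: "a \<noteq> 0" "b \<noteq> 0" "c \<noteq> 0" "d \<noteq> 0" "e \<noteq> 0" "g \<noteq> 0" "X \<noteq> 0"
  by (auto simp: X_def intro!: fps_nonzero_if_nth_0)

private lemma dX: "qderiv X = X"
  by (simp add: X_def qderiv_X)

private lemma modular: "4 * X * b * d = a * c - e * g"
  using modular_equation_3 by (simp add: a_def b_def c_def d_def e_def g_def X_def)

private lemma quartic: "16 * X * b ^ 4 = a ^ 4 - e ^ 4"
  using jacobi_quartic by (simp add: a_def b_def e_def X_def algebra_simps)

private lemma quartic3: "16 * X ^ 3 * d ^ 4 = c ^ 4 - g ^ 4"
  using arg_cong [OF jacobi_quartic, of "dil 3"]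
  by (simp add: c_def d_def g_def X_def dil_simps dil_dil)

private lemma W: "4 * (a * qderiv b - b * qderiv a) = a * b * e ^ 4 - a * b"
  using theta_wronskian by (simp add: a_def b_def e_def algebra_simps)

private lemma W3: "4 * (c * qderiv d - d * qderiv c) = 3 * (c * d * g ^ 4 - c * d)"
proof -
  have "qderiv c = 3 * dil 3 (qderiv phi)" "qderiv d = 3 * dil 3 (qderiv (dil 2 psi))" "d = dil 3 (dil 2 psi)"
    by (simp_all add: c_def d_def qderiv_dil dil_dil dil_simps)
  then show ?thesis
    using arg_cong [OF theta_wronskian, of "\<lambda>F. 3 * dil 3 F"]
    by (simp add: c_def g_def dil_mult dil_add dil_diff dil_power dil_numeral algebra_simps)
qed

private lemma E: "a * qderiv e = e * qderiv a - 4 * X * a * b ^ 4 * e"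
  using alt_phi_qderiv by (simp add: a_def b_def e_def X_def algebra_simps)

private lemma G: "c * qderiv g = g * qderiv c - 12 * X ^ 3 * c * d ^ 4 * g"
proof -
  have "qderiv c = 3 * dil 3 (qderiv phi)" "qderiv g = 3 * dil 3 (qderiv (alt phi))" "d = dil 3 (dil 2 psi)"
    by (simp_all add: c_def d_def g_def qderiv_dil dil_dil dil_simps)
  then show ?thesis
    using arg_cong [OF alt_phi_qderiv, of "\<lambda>F. 3 * dil 3 F"]
    by (simp add: c_def g_def X_def dil_simps algebra_simps)
qed

private lemma qderiv_bd:
  "4 * a * c * (b * qderiv d + d * qderiv b) =
    4 * b * d * (a * qderiv c + c * qderiv a) + a * b * c * d * (e ^ 4 + 3 * g ^ 4) - 4 * a * b * c * d"
proof -
  have "4 * a * c * (b * qderiv d + d * qderiv b) =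
      a * b * (4 * (c * qderiv d - d * qderiv c)) + c * d * (4 * (a * qderiv b - b * qderiv a)) +
      4 * b * d * (a * qderiv c + c * qderiv a)"
    by (simp add: algebra_simps)
  then show ?thesis unfolding W W3 by (simp add: algebra_simps)
qed

text \<open>The logarithmic derivatives of \<open>4q b d / (a c)\<close> and of \<open>e g / (a c)\<close> are known from the differential
  equation. The modular equation says that these two functions add up to 1, so their derivatives cancel;
  this gives a second relation between \<open>a\<close>, \<open>c\<close>, \<open>e\<close> and \<open>g\<close>.\<close>

private lemma star: "a * c * (e ^ 4 + 3 * g ^ 4) = e * g * (a ^ 4 + 3 * c ^ 4)"
proof -
  have "4 * X * (b * qderiv d + d * qderiv b) + 4 * X * b * d =
      a * qderiv c + c * qderiv a - e * qderiv g - g * qderiv e"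
    using arg_cong [OF modular, of qderiv] by (simp add: qderiv_simps dX algebra_simps)
  then have "a * c * (4 * X * (b * qderiv d + d * qderiv b) + 4 * X * b * d) =
      a * c * (a * qderiv c + c * qderiv a - e * qderiv g - g * qderiv e)"
    by (rule arg_cong)
  then have "X * (4 * a * c * (b * qderiv d + d * qderiv b)) + 4 * X * a * b * c * d =
      a * c * (a * qderiv c + c * qderiv a) - e * a * (c * qderiv g) - g * c * (a * qderiv e)"
    by (simp add: algebra_simps)
  then have "4 * X * b * d * (a * qderiv c + c * qderiv a) + X * a * b * c * d * (e ^ 4 + 3 * g ^ 4) =
      (a * c - e * g) * (a * qderiv c + c * qderiv a) + a * c * (e * g * (12 * X ^ 3 * d ^ 4 + 4 * X * b ^ 4))"
    unfolding qderiv_bd E G by (simp add: algebra_simps)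
  then have "a * c * (X * b * d * (e ^ 4 + 3 * g ^ 4)) = a * c * (e * g * (12 * X ^ 3 * d ^ 4 + 4 * X * b ^ 4))"
    unfolding modular by (simp add: algebra_simps)
  then have "X * b * d * (e ^ 4 + 3 * g ^ 4) = e * g * (12 * X ^ 3 * d ^ 4 + 4 * X * b ^ 4)"
    by (simp only: mult_left_cancel nonzero mult_eq_0_iff simp_thms)
  then have "4 * (X * b * d * (e ^ 4 + 3 * g ^ 4)) = 4 * (e * g * (12 * X ^ 3 * d ^ 4 + 4 * X * b ^ 4))"
    by (rule arg_cong)
  then have "(4 * X * b * d) * (e ^ 4 + 3 * g ^ 4) = e * g * (3 * (16 * X ^ 3 * d ^ 4) + 16 * X * b ^ 4)"
    by (simp add: algebra_simps)
  then show ?thesis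
    unfolding modular quartic quartic3 by (simp add: algebra_simps)
qed

text \<open>The fourth power of the modular equation, with \<open>b\<close> and \<open>d\<close> eliminated by the quartic relations.\<close>

private lemma starstar:
  "a ^ 4 * g ^ 4 + c ^ 4 * e ^ 4 + 6 * (a * c)\<^sup>2 * (e * g)\<^sup>2 =
    4 * (a * c) ^ 3 * (e * g) + 4 * (a * c) * (e * g) ^ 3"
proof -
  have "(a * c - e * g) ^ 4 = (16 * X * b ^ 4) * (16 * X ^ 3 * d ^ 4)"
    by (simp flip: modular add: power_mult_distrib eval_nat_numeral algebra_simps)
  then show ?thesis
    unfolding quartic quartic3 by (simp add: algebra_simps eval_nat_numeral)
qed


private lemma nth_1: "a $ 1 = 2" "c $ 1 = 0" "e $ 1 = - 2" "g $ 1 = 0"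
proof -
  show a1: "a $ 1 = 2"
    unfolding a_def by (subst phi_split) (simp add: dil_nth mult.assoc numeral_fps_const)
  show "c $ 1 = 0" "g $ 1 = 0"
    by (simp_all add: c_def g_def dil_nth)
  show "e $ 1 = - 2"
    using a1 by (simp add: a_def e_def alt_nth)
qed

text \<open>With \<open>x = a^2/c^2\<close> and \<open>y = e^2/g^2\<close>, eliminating the product \<open>a c e g\<close> from the two preceding relations
  leaves \<open>3 (x - y)^2 ((x + y)^2 - (x y - 3)^2) = 0\<close>. The coefficient of \<open>q\<close> excludes \<open>x = y\<close> and the
  constant coefficient excludes \<open>x + y = x y - 3\<close>, so \<open>x + y + x y = 3\<close>.\<close>

lemma degree3_e_g: "e\<^sup>2 * (a\<^sup>2 + c\<^sup>2) = g\<^sup>2 * (3 * c\<^sup>2 - a\<^sup>2)"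
proof -
  define A C K G where "A = a\<^sup>2" and "C = c\<^sup>2" and "K = e\<^sup>2" and "G = g\<^sup>2"
  define x y where "x = a * c" and "y = e * g"
  have xx: "x * x = A * C" and yy: "y * y = K * G"
    by (simp_all add: x_def y_def A_def C_def K_def G_def power2_eq_square)
  have 1: "x * (K\<^sup>2 + 3 * G\<^sup>2) = y * (A\<^sup>2 + 3 * C\<^sup>2)"
    using star by (simp add: x_def y_def A_def C_def K_def G_def)
  have 2: "A\<^sup>2 * G\<^sup>2 + C\<^sup>2 * K\<^sup>2 + 6 * (A * C) * (K * G) = 4 * (x * x) * (x * y) + 4 * (y * y) * (x * y)"
    using starstar unfolding xx [symmetric] yy [symmetric]
    by (simp add: x_def y_def A_def C_def K_def G_def eval_nat_numeral ac_simps)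
  have 3: "(x * y) * ((K\<^sup>2 + 3 * G\<^sup>2) * (A\<^sup>2 + 3 * C\<^sup>2)) = (x * x) * (K\<^sup>2 + 3 * G\<^sup>2)\<^sup>2"
  proof -
    have "(x * y) * ((K\<^sup>2 + 3 * G\<^sup>2) * (A\<^sup>2 + 3 * C\<^sup>2)) =
        x * (K\<^sup>2 + 3 * G\<^sup>2) * (y * (A\<^sup>2 + 3 * C\<^sup>2))" by (simp only: ac_simps)
    then show ?thesis unfolding 1 [symmetric] by (simp only: power2_eq_square ac_simps)
  qed
  have 4: "(x * y) * ((K\<^sup>2 + 3 * G\<^sup>2) * (A\<^sup>2 + 3 * C\<^sup>2)) = (y * y) * (A\<^sup>2 + 3 * C\<^sup>2)\<^sup>2"
  proof -
    have "(x * y) * ((K\<^sup>2 + 3 * G\<^sup>2) * (A\<^sup>2 + 3 * C\<^sup>2)) =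
        x * (K\<^sup>2 + 3 * G\<^sup>2) * (y * (A\<^sup>2 + 3 * C\<^sup>2))" by (simp only: ac_simps)
    then show ?thesis unfolding 1 by (simp only: power2_eq_square ac_simps)
  qed
  have "(A\<^sup>2 * G\<^sup>2 + C\<^sup>2 * K\<^sup>2 + 6 * (A * C) * (K * G)) * ((K\<^sup>2 + 3 * G\<^sup>2) * (A\<^sup>2 + 3 * C\<^sup>2)) =
      4 * (x * x) * ((x * y) * ((K\<^sup>2 + 3 * G\<^sup>2) * (A\<^sup>2 + 3 * C\<^sup>2))) +
      4 * (y * y) * ((x * y) * ((K\<^sup>2 + 3 * G\<^sup>2) * (A\<^sup>2 + 3 * C\<^sup>2)))"
    unfolding 2 by (simp only: distrib_right ac_simps)
  also have "\<dots> = 4 * (x * x) * ((x * x) * (K\<^sup>2 + 3 * G\<^sup>2)\<^sup>2) + 4 * (y * y) * ((y * y) * (A\<^sup>2 + 3 * C\<^sup>2)\<^sup>2)"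
    by (subst 3, subst 4) (rule refl)
  also have "\<dots> = 4 * (A * C) * ((A * C) * (K\<^sup>2 + 3 * G\<^sup>2)\<^sup>2) + 4 * (K * G) * ((K * G) * (A\<^sup>2 + 3 * C\<^sup>2)\<^sup>2)"
    by (simp only: xx yy)
  finally have "3 * ((A * G - K * C)\<^sup>2 * ((A * G + K * C - A * K + 3 * C * G) * (A * G + K * C + A * K - 3 * C * G))) = 0"
    by (simp add: algebra_simps power2_eq_square)
  moreover have "A * G - K * C \<noteq> 0"
  proof -
    have "(A * G - K * C) $ 1 = 8"
      by (simp add: A_def C_def K_def G_def power2_eq_square fps_mult_nth_1 nth_1 [unfolded One_nat_def])
    then show ?thesis by (intro fps_nonzero_if_nth [of _ 1]) simp
  qed
  moreover have "A * G + K * C - A * K + 3 * C * G \<noteq> 0"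
  proof -
    have "(A * G + K * C - A * K + 3 * C * G) $ 0 = 4"
      by (simp add: A_def C_def K_def G_def power2_eq_square)
    then show ?thesis by (intro fps_nonzero_if_nth [of _ 0]) simp
  qed
  ultimately have "A * G + K * C + A * K - 3 * C * G = 0"
    by simp
  then show ?thesis
    by (simp add: A_def C_def K_def G_def algebra_simps)
qed


private lemma aux_squares:
  "(a\<^sup>2 + c\<^sup>2)\<^sup>2 * (e ^ 4 + 3 * g ^ 4) = 4 * g ^ 4 * (a ^ 4 + 3 * c ^ 4)"
proof -
  have "(a\<^sup>2 + c\<^sup>2)\<^sup>2 * (e ^ 4 + 3 * g ^ 4) = (e\<^sup>2 * (a\<^sup>2 + c\<^sup>2))\<^sup>2 + 3 * g ^ 4 * (a\<^sup>2 + c\<^sup>2)\<^sup>2"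
    by (simp only: power_mult_distrib) (simp add: distrib_left ac_simps)
  then show ?thesis
    unfolding degree3_e_g by (simp add: algebra_simps eval_nat_numeral)
qed

text \<open>By the preceding lemma, \<open>e^4 + 3 g^4\<close> is a multiple of \<open>a^4 + 3 c^4\<close>, which then cancels in the relation
  between the logarithmic derivatives.\<close>

lemma degree3_g: "4 * (a * c) * g ^ 4 = (e * g) * (a\<^sup>2 + c\<^sup>2)\<^sup>2"
proof -
  have "(a ^ 4 + 3 * c ^ 4) * (4 * (a * c) * g ^ 4) = (a\<^sup>2 + c\<^sup>2)\<^sup>2 * (a * c * (e ^ 4 + 3 * g ^ 4))"
    using arg_cong [OF aux_squares, of "\<lambda>F. a * c * F"] by (simp only: ac_simps)
  also have "\<dots> = (a ^ 4 + 3 * c ^ 4) * ((e * g) * (a\<^sup>2 + c\<^sup>2)\<^sup>2)"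
    unfolding star by (simp only: ac_simps)
  finally have "(a ^ 4 + 3 * c ^ 4) * (4 * (a * c) * g ^ 4) = (a ^ 4 + 3 * c ^ 4) * ((e * g) * (a\<^sup>2 + c\<^sup>2)\<^sup>2)" .
  moreover have "(a ^ 4 + 3 * c ^ 4) $ 0 = 4"
    by (simp add: fps_nth_power_0)
  then have "a ^ 4 + 3 * c ^ 4 \<noteq> 0" by (intro fps_nonzero_if_nth [of _ 0]) simp
  ultimately show ?thesis by (rule fps_cancel_left)
qed

lemma degree3_prod_eg: "4 * (a * c) * (e * g) = (3 * c\<^sup>2 - a\<^sup>2) * (a\<^sup>2 + c\<^sup>2)"
proof -
  have "g\<^sup>2 * (g\<^sup>2 * (4 * (a * c) * (e * g))) = (e * g) * (4 * (a * c) * g ^ 4)"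
    by (simp add: eval_nat_numeral algebra_simps)
  also have "\<dots> = g\<^sup>2 * ((e\<^sup>2 * (a\<^sup>2 + c\<^sup>2)) * (a\<^sup>2 + c\<^sup>2))"
    unfolding degree3_g by (simp add: eval_nat_numeral algebra_simps)
  also have "\<dots> = g\<^sup>2 * (g\<^sup>2 * ((3 * c\<^sup>2 - a\<^sup>2) * (a\<^sup>2 + c\<^sup>2)))"
    unfolding degree3_e_g by (simp only: ac_simps)
  finally show ?thesis
    by (simp only: mult_left_cancel nonzero power_not_zero not_False_eq_True)
qed

lemma degree3_prod_abcd: "16 * X * (a * b * c * d) = (a\<^sup>2 - c\<^sup>2) * (a\<^sup>2 + 3 * c\<^sup>2)"
proof -
  have "16 * X * (a * b * c * d) = 4 * (a * c) * (4 * X * b * d)"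
    by (simp only: ac_simps) simp
  also have "\<dots> = 4 * (a * c) * (a * c) - 4 * (a * c) * (e * g)"
    unfolding modular by (simp only: right_diff_distrib)
  also have "\<dots> = (a\<^sup>2 - c\<^sup>2) * (a\<^sup>2 + 3 * c\<^sup>2)"
    unfolding degree3_prod_eg by (simp add: eval_nat_numeral algebra_simps)
  finally show ?thesis .
qed

lemma degree3_g4: "16 * (a\<^sup>2 * c\<^sup>2) * g ^ 4 = (3 * c\<^sup>2 - a\<^sup>2) * (a\<^sup>2 + c\<^sup>2) ^ 3"
proof -
  have "16 * (a\<^sup>2 * c\<^sup>2) * g ^ 4 = 4 * (a * c) * (4 * (a * c) * g ^ 4)"
    by (simp add: power2_eq_square ac_simps)
  also have "\<dots> = (4 * (a * c) * (e * g)) * (a\<^sup>2 + c\<^sup>2)\<^sup>2"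
    unfolding degree3_g by (simp only: ac_simps)
  finally show ?thesis
    unfolding degree3_prod_eg by (simp add: eval_nat_numeral ac_simps)
qed

lemma degree3_e4: "16 * (a\<^sup>2 * c\<^sup>2) * e ^ 4 = (3 * c\<^sup>2 - a\<^sup>2) ^ 3 * (a\<^sup>2 + c\<^sup>2)"
proof -
  have "(a\<^sup>2 + c\<^sup>2)\<^sup>2 * (16 * (a\<^sup>2 * c\<^sup>2) * e ^ 4) = 16 * (a\<^sup>2 * c\<^sup>2) * (e\<^sup>2 * (a\<^sup>2 + c\<^sup>2))\<^sup>2"
    by (simp add: power_mult_distrib ac_simps)
  also have "\<dots> = (16 * (a\<^sup>2 * c\<^sup>2) * g ^ 4) * (3 * c\<^sup>2 - a\<^sup>2)\<^sup>2"
    unfolding degree3_e_g by (simp add: power_mult_distrib ac_simps)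
  also have "\<dots> = (a\<^sup>2 + c\<^sup>2)\<^sup>2 * ((3 * c\<^sup>2 - a\<^sup>2) ^ 3 * (a\<^sup>2 + c\<^sup>2))"
    unfolding degree3_g4 by (simp only: eval_nat_numeral power_Suc power_0 mult_1_right ac_simps)
  finally have "(a\<^sup>2 + c\<^sup>2)\<^sup>2 * (16 * (a\<^sup>2 * c\<^sup>2) * e ^ 4) = (a\<^sup>2 + c\<^sup>2)\<^sup>2 * ((3 * c\<^sup>2 - a\<^sup>2) ^ 3 * (a\<^sup>2 + c\<^sup>2))" .
  moreover have "(a\<^sup>2 + c\<^sup>2)\<^sup>2 $ 0 = 4" by (simp add: fps_nth_power_0)
  then have "(a\<^sup>2 + c\<^sup>2)\<^sup>2 \<noteq> 0" by (intro fps_nonzero_if_nth [of _ 0]) simp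
  ultimately show ?thesis by (rule fps_cancel_left)
qed

lemma degree3_d4: "256 * (X ^ 3 * d ^ 4 * (a\<^sup>2 * c\<^sup>2)) = (a\<^sup>2 - c\<^sup>2) ^ 3 * (a\<^sup>2 + 3 * c\<^sup>2)"
proof -
  have "256 * (X ^ 3 * d ^ 4 * (a\<^sup>2 * c\<^sup>2)) = 16 * (a\<^sup>2 * c\<^sup>2) * (16 * X ^ 3 * d ^ 4)"
    by (simp add: ac_simps)
  also have "\<dots> = 16 * (a\<^sup>2 * c\<^sup>2) * c ^ 4 - 16 * (a\<^sup>2 * c\<^sup>2) * g ^ 4"
    unfolding quartic3 by (simp only: right_diff_distrib)
  finally show ?thesis
    unfolding degree3_g4 by (simp add: eval_nat_numeral algebra_simps)
qed

lemma degree3_b4: "256 * (X * b ^ 4 * (a\<^sup>2 * c\<^sup>2)) = (a\<^sup>2 - c\<^sup>2) * (a\<^sup>2 + 3 * c\<^sup>2) ^ 3"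
proof -
  have "256 * (X * b ^ 4 * (a\<^sup>2 * c\<^sup>2)) = 16 * (a\<^sup>2 * c\<^sup>2) * (16 * X * b ^ 4)"
    by (simp add: ac_simps)
  also have "\<dots> = 16 * (a\<^sup>2 * c\<^sup>2) * a ^ 4 - 16 * (a\<^sup>2 * c\<^sup>2) * e ^ 4"
    unfolding quartic by (simp only: right_diff_distrib)
  finally show ?thesis
    unfolding degree3_e4 by (simp add: eval_nat_numeral algebra_simps)
qed

text \<open>This is \<open>\<Theta>(a^2/c^2)\<close> up to the factor \<open>c^4\<close>: differentiate the expression for \<open>16 q a b c d\<close>, with the
  logarithmic derivative of \<open>q b d / (a c)\<close> from the differential equation.\<close>

lemma degree3_qderiv:
  "16 * (c\<^sup>2 * qderiv (a\<^sup>2) - a\<^sup>2 * qderiv (c\<^sup>2)) =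
    (a\<^sup>2 - c\<^sup>2) * (a\<^sup>2 + 3 * c\<^sup>2) * (3 * c\<^sup>2 - a\<^sup>2) * (a\<^sup>2 + c\<^sup>2)"
proof -
  define A C N s where "A = a\<^sup>2" and "C = c\<^sup>2" and "N = (A - C) * (A + 3 * C)"
    and "s = a * qderiv c + c * qderiv a"
  define dA dC where "dA = qderiv A" and "dC = qderiv C"
  have J1: "16 * X * (a * b * c * d) = N"
    using degree3_prod_abcd by (simp add: A_def C_def N_def)
  have AC: "A * C = (a * c) * (a * c)" by (simp add: A_def C_def power2_eq_square)
  have s: "2 * (a * c) * s = A * dC + C * dA"
    by (simp add: A_def C_def dA_def dC_def s_def qderiv_simps algebra_simps power2_eq_square)
  have dN: "qderiv N = 2 * A * dA + 2 * A * dC + 2 * C * dA - 6 * C * dC"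
    unfolding N_def by (simp add: dA_def dC_def qderiv_simps algebra_simps)
  have "4 * (A * C) * qderiv N = 4 * (A * C) * qderiv (16 * X * (a * b * c * d))"
    by (simp only: J1)
  also have "\<dots> = 16 * X * (4 * (a * c) * (a * c) * (a * b * c * d) +
      4 * (a * c) * (a * c) * s * (b * d) + (a * c) * (a * c) * (4 * a * c * (b * qderiv d + d * qderiv b)))"
    unfolding AC s_def by (simp add: qderiv_simps dX algebra_simps)
  also have "\<dots> = 16 * X * (a * b * c * d) * (4 * (2 * (a * c) * s) + (A * C) * (e ^ 4 + 3 * g ^ 4))"
    unfolding qderiv_bd AC s_def by (simp add: algebra_simps)
  finally have 1: "4 * (A * C) * qderiv N = N * (4 * (A * dC + C * dA) + (A * C) * (e ^ 4 + 3 * g ^ 4))"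
    unfolding J1 s .
  have "4 * (A\<^sup>2 + 3 * C\<^sup>2) * (C * dA - A * dC) = 4 * (A * C) * qderiv N - 4 * N * (A * dC + C * dA)"
    unfolding dN by (simp add: N_def algebra_simps power2_eq_square)
  also have "\<dots> = N * (A * C) * (e ^ 4 + 3 * g ^ 4)"
    unfolding 1 by (simp add: algebra_simps)
  finally have 2: "4 * (A\<^sup>2 + 3 * C\<^sup>2) * (C * dA - A * dC) = N * (A * C) * (e ^ 4 + 3 * g ^ 4)" .
  have 3: "(A + C)\<^sup>2 * (e ^ 4 + 3 * g ^ 4) = 4 * g ^ 4 * (A\<^sup>2 + 3 * C\<^sup>2)"
    using aux_squares by (simp add: A_def C_def)
  have 4: "16 * (A * C) * g ^ 4 = (3 * C - A) * (A + C) ^ 3"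
    using degree3_g4 by (simp add: A_def C_def)
  have "(4 * (A\<^sup>2 + 3 * C\<^sup>2) * (A + C)\<^sup>2) * (16 * (C * dA - A * dC)) =
      16 * (A + C)\<^sup>2 * (4 * (A\<^sup>2 + 3 * C\<^sup>2) * (C * dA - A * dC))"
    by (simp only: ac_simps)
  also have "\<dots> = 16 * N * (A * C) * ((A + C)\<^sup>2 * (e ^ 4 + 3 * g ^ 4))"
    unfolding 2 by (simp only: ac_simps)
  also have "\<dots> = 4 * N * (A\<^sup>2 + 3 * C\<^sup>2) * (16 * (A * C) * g ^ 4)"
    unfolding 3 by (simp only: ac_simps)
  also have "\<dots> = (4 * (A\<^sup>2 + 3 * C\<^sup>2) * (A + C)\<^sup>2) * (N * (3 * C - A) * (A + C))"
    unfolding 4 by (simp only: eval_nat_numeral power_Suc power_0 mult_1_right ac_simps)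
  finally have "(4 * (A\<^sup>2 + 3 * C\<^sup>2) * (A + C)\<^sup>2) * (16 * (C * dA - A * dC)) =
      (4 * (A\<^sup>2 + 3 * C\<^sup>2) * (A + C)\<^sup>2) * (N * (3 * C - A) * (A + C))" .
  moreover have "(4 * (A\<^sup>2 + 3 * C\<^sup>2) * (A + C)\<^sup>2) $ 0 = 64"
    by (simp add: A_def C_def fps_nth_power_0)
  then have "4 * (A\<^sup>2 + 3 * C\<^sup>2) * (A + C)\<^sup>2 \<noteq> 0"
    by (intro fps_nonzero_if_nth [of _ 0]) simp
  ultimately have "16 * (C * dA - A * dC) = N * (3 * C - A) * (A + C)"
    by (rule fps_cancel_left)
  then show ?thesis by (simp add: A_def C_def N_def dA_def dC_def)
qed

lemmas degree3 =
  degree3_prod_eg degree3_prod_abcd degree3_g4 degree3_d4 degree3_b4 degree3_qderiv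

text \<open>The central exactness statement. Multiplication by \<open>(g^2 a^3 c^3)^5\<close> turns every term into a monomial
  in the left sides of the relations of degree three; these are then replaced by polynomials in
  \<open>A = a^2\<close> and \<open>C = c^2\<close>. The linear factors of these polynomials contain those of the derivative
  \<open>C \<Theta>A - A \<Theta>C\<close>, and the cofactor is \<open>C^2\<close> times the polynomial treated above, times the fifth power
  of \<open>A + C\<close>.\<close>

lemma mod5_exact_theta_form:
  fixes M :: "int fps"
  defines "M \<equiv> a * c + 4 * X * b * d"
  shows "mod5_exact (X ^ 3 * (e * g ^ 3 * c ^ 3 * d ^ 3 *
    (- (a ^ 11 * d * M) - 4 * X * a ^ 5 * b ^ 5 * (b\<^sup>2 * c\<^sup>2 - X * a\<^sup>2 * d\<^sup>2) + 4 * X\<^sup>2 * b ^ 11 * c * M)))"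
    (is "mod5_exact ?S")
proof -
  define A C W j where "A = a\<^sup>2" and "C = c\<^sup>2" and "W = C * qderiv A - A * qderiv C"
    and "j = A\<^sup>2 + 6 * A * C - 3 * C\<^sup>2"
  have acM: "4 * (a * c * M) = j"
  proof -
    have "4 * (a * c * M) = 4 * (a\<^sup>2 * c\<^sup>2) + 16 * X * (a * b * c * d)"
      by (simp add: M_def algebra_simps power2_eq_square)
    then show ?thesis
      unfolding degree3 by (simp add: j_def A_def C_def algebra_simps power2_eq_square)
  qed
  define m1 m2 m3 m4 where "m1 = a * c * M" and "m2 = X * (a * b * c * d)"
    and "m3 = X ^ 3 * d ^ 4 * (a\<^sup>2 * c\<^sup>2)" and "m4 = X * b ^ 4 * (a\<^sup>2 * c\<^sup>2)"
  have "(g\<^sup>2 * a ^ 3 * c ^ 3) ^ 5 * ?S = ((a * c) * (e * g)) * ((a\<^sup>2 * c\<^sup>2) * g ^ 4) ^ 3 * (c ^ 4 *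
      (- (a ^ 16 * c ^ 4 * (m1 * m3)) - 4 * (a\<^sup>2) ^ 4 * (c\<^sup>2)\<^sup>2 * (m2 ^ 3 * m4) +
        4 * (a\<^sup>2) ^ 5 * c\<^sup>2 * m2 ^ 5 + 4 * (m1 * m2 ^ 3 * m4\<^sup>2)))"
    unfolding m1_def m2_def m3_def m4_def by algebra
  \<comment> \<open>\<open>2^44\<close> clears the factors 4, 16 and 256 in the relations; it is congruent to 1 modulo 5\<close>
  then have "2 ^ 44 * ((g\<^sup>2 * a ^ 3 * c ^ 3) ^ 5 * ?S) =
      (4 * (a * c) * (e * g)) * (16 * (a\<^sup>2 * c\<^sup>2) * g ^ 4) ^ 3 * (C\<^sup>2 *
      (- (2 ^ 20) * A ^ 8 * C\<^sup>2 * ((4 * m1) * (256 * m3)) - 2 ^ 12 * A ^ 4 * C\<^sup>2 * ((16 * m2) ^ 3 * (256 * m4)) +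
        2 ^ 12 * A ^ 5 * C * (16 * m2) ^ 5 + 4 * ((4 * m1) * (16 * m2) ^ 3 * (256 * m4)\<^sup>2)))"
    unfolding A_def C_def by algebra
  also have "\<dots> = ((3 * C - A) * (A + C)) * ((3 * C - A) * (A + C) ^ 3) ^ 3 * (C\<^sup>2 *
      (- (2 ^ 20) * A ^ 8 * C\<^sup>2 * (j * ((A - C) ^ 3 * (A + 3 * C))) -
        2 ^ 12 * A ^ 4 * C\<^sup>2 * (((A - C) * (A + 3 * C)) ^ 3 * ((A - C) * (A + 3 * C) ^ 3)) +
        2 ^ 12 * A ^ 5 * C * ((A - C) * (A + 3 * C)) ^ 5 +
        4 * (j * ((A - C) * (A + 3 * C)) ^ 3 * ((A - C) * (A + 3 * C) ^ 3)\<^sup>2)))"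
  proof -
    have "16 * m2 = (A - C) * (A + 3 * C)" "256 * m3 = (A - C) ^ 3 * (A + 3 * C)"
      "256 * m4 = (A - C) * (A + 3 * C) ^ 3" "4 * m1 = j"
      using degree3(2,4,5) acM
      by (simp_all only: m1_def m2_def m3_def m4_def A_def C_def mult.assoc)
    then show ?thesis
      by (simp only: A_def [symmetric] C_def [symmetric] degree3(1,3) [folded A_def C_def])
  qed
  also have "\<dots> = (A + C) ^ 5 * (C\<^sup>2 * ((A + C) ^ 4 * (3 * C - A) ^ 3 * (A - C)\<^sup>2 *
    (- (2 ^ 20) * A ^ 8 * C\<^sup>2 * j - 2 ^ 12 * A ^ 4 * C\<^sup>2 * ((A - C) * (A + 3 * C) ^ 5) +
      2 ^ 12 * A ^ 5 * C * ((A - C)\<^sup>2 * (A + 3 * C) ^ 4) + 4 * j * ((A - C)\<^sup>2 * (A + 3 * C) ^ 8))) *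
      ((A - C) * (A + 3 * C) * (3 * C - A) * (A + C)))" (is "_ = (A + C) ^ 5 * (?P * _)")
    by algebra
  also have "(A - C) * (A + 3 * C) * (3 * C - A) * (A + C) = 16 * W"
    using degree3(6) by (simp only: A_def C_def W_def)
  finally have eq: "of_int (2 ^ 44) * ((g\<^sup>2 * a ^ 3 * c ^ 3) ^ 5 * ?S) =
      of_int 16 * ((A + C) ^ 5 * (?P * W))"
    by (simp only: of_int_power of_int_numeral ac_simps)
  have "mod5_exact (of_int (2 ^ 44) * ((g\<^sup>2 * a ^ 3 * c ^ 3) ^ 5 * ?S))"
    unfolding eq W_def j_def
    by (intro mod5_exact_numeral_mult mod5_exact_fifth_power_mult mod5_exact_polynomial)
  then have "mod5_exact ((g\<^sup>2 * a ^ 3 * c ^ 3) ^ 5 * ?S)"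
    by (rule mod5_exact_unit_cancel [where j = 1]) simp
  then show ?thesis
    by (rule mod5_exact_fifth_power_cancel) (simp add: fps_nth_power_0)
qed

end

section \<open>The triple product identity\<close>

definition agree :: "nat \<Rightarrow> 'a :: comm_ring_1 fps \<Rightarrow> 'a fps \<Rightarrow> bool" where
  "agree n F G \<longleftrightarrow> fps_X ^ n dvd F - G"

lemma X_power_dvd_iff: "fps_X ^ n dvd (F :: 'a :: comm_ring_1 fps) \<longleftrightarrow> (\<forall>i<n. F $ i = 0)"
proof
  assume "fps_X ^ n dvd F"
  then show "\<forall>i<n. F $ i = 0" by (auto simp: fps_X_power_mult_nth elim!: dvdE)
next
  assume *: "\<forall>i<n. F $ i = 0"
  have "F = fps_X ^ n * fps_shift n F"
    by (rule fps_ext) (simp add: fps_X_power_mult_nth *)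
  then show "fps_X ^ n dvd F" by (metis dvd_triv_left)
qed

lemma agree_iff_nth: "agree n F G \<longleftrightarrow> (\<forall>i<n. F $ i = G $ i)"
  by (simp add: agree_def X_power_dvd_iff)

lemma agree_refl [simp]: "agree n F F"
  by (simp add: agree_def)

lemma agree_sym: "agree n F G \<Longrightarrow> agree n G F"
  by (simp add: agree_iff_nth)

lemma agree_trans [trans]: "agree n F G \<Longrightarrow> agree n G H \<Longrightarrow> agree n F H"
  by (simp add: agree_iff_nth)

lemma agree_mono: "agree n F G \<Longrightarrow> m \<le> n \<Longrightarrow> agree m F G"
  by (simp add: agree_iff_nth)

lemma agree_mult:
  assumes "agree n F F'" "agree n G G'"
  shows "agree n (F * G) (F' * G')"
proof -
  have "F * G - F' * G' = (F - F') * G + F' * (G - G')"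
    by (simp add: algebra_simps)
  then show ?thesis
    using assms by (simp add: agree_def)
qed

lemma agree_power: "agree n F G \<Longrightarrow> agree n (F ^ k) (G ^ k)"
  by (induction k) (auto intro: agree_mult)

lemma agree_sum: "(\<And>j. j \<in> J \<Longrightarrow> agree n (F j) (G j)) \<Longrightarrow> agree n (sum F J) (sum G J)"
  by (simp add: agree_iff_nth fps_sum_nth)

lemma agree_shift:
  assumes "agree n F G"
  shows "agree (k + n) (fps_X ^ k * F) (fps_X ^ k * G)"
  using assms by (simp add: agree_def power_add mult_dvd_mono flip: right_diff_distrib)

lemma agree_dil:
  assumes "agree n F G" "k > 0"
  shows "agree (k * n) (dil k F) (dil k G)"
proof -
  obtain H where H: "F - G = fps_X ^ n * H"
    using assms(1) unfolding agree_def by (rule dvdE)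
  have "dil k F - dil k G = dil k (fps_X ^ n * H)"
    by (simp add: dil_diff flip: H)
  also have "\<dots> = fps_X ^ (k * n) * dil k H"
    using assms(2) by (simp add: dil_simps power_mult)
  finally show ?thesis by (simp add: agree_def)
qed

lemma eqI_agree: "(\<And>n. agree (Suc n) F G) \<Longrightarrow> F = G"
  by (rule fps_ext) (metis agree_iff_nth lessI)

definition euler_partial :: "nat \<Rightarrow> int fps" where
  "euler_partial n = (\<Prod>i<n. 1 - fps_X ^ Suc i)"

definition euler :: "int fps" where
  "euler = Abs_fps (\<lambda>m. euler_partial m $ m)"

lemma euler_partial_Suc: "euler_partial (Suc n) = euler_partial n * (1 - fps_X ^ Suc n)"
  by (simp add: euler_partial_def)

lemma agree_euler_partial: "agree (Suc n) euler (euler_partial n)"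
proof -
  have "euler_partial n $ i = euler_partial i $ i" if "i \<le> n" for i
    using that
  proof (induction n rule: dec_induct)
    case (step n)
    have "euler_partial (Suc n) $ i = (euler_partial n - fps_X ^ Suc n * euler_partial n) $ i"
      by (simp only: euler_partial_Suc right_diff_distrib mult_1_right mult.commute [of _ "fps_X ^ _"])
    also have "\<dots> = euler_partial n $ i"
      using step.hyps by (simp only: fps_sub_nth fps_X_power_mult_nth) simp
    finally show ?case using step.IH by simp
  qed simp
  then show ?thesis by (simp add: agree_iff_nth euler_def)
qed

lemma euler_partial_nth_0 [simp]: "euler_partial n $ 0 = 1"
  by (induction n) (simp_all add: euler_partial_Suc, simp add: euler_partial_def)

lemma euler_nth_0 [simp]: "euler $ 0 = 1"
  by (simp add: euler_def)

lemma dil_euler_partial: "k > 0 \<Longrightarrow> dil k (euler_partial n) = (\<Prod>i<n. 1 - fps_X ^ (k * Suc i))"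
proof (induction n)
  case (Suc n)
  have "dil k (1 - fps_X ^ Suc n) = 1 - fps_X ^ (k * Suc n)"
    using Suc.prems by (simp only: dil_simps power_mult)
  with Suc show ?case by (simp add: euler_partial_Suc dil_mult)
qed (simp add: euler_partial_def dil_1)

text \<open>Reciprocals of the finite products. The value 0 at negative arguments makes the recurrence below
  hold for all integers; it plays the part of \<open>1/(q; q)_m = 0\<close> for \<open>m < 0\<close>.\<close>

definition inv_euler_partial :: "int \<Rightarrow> int fps" where
  "inv_euler_partial m = (if m < 0 then 0 else fps_right_inverse (euler_partial (nat m)) 1)"

lemma inv_euler_partial: "m \<ge> 0 \<Longrightarrow> euler_partial (nat m) * inv_euler_partial m = 1"
  by (simp add: inv_euler_partial_def fps_right_inverse)

lemma inv_euler_partial_diff_1: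
  "inv_euler_partial (m - 1) = (1 - fps_X ^ nat m) * inv_euler_partial m"
proof (cases "m > 0")
  case True
  define n where "n = nat (m - 1)"
  have n: "nat m = Suc n" using True by (simp add: n_def)
  have "euler_partial n * ((1 - fps_X ^ nat m) * inv_euler_partial m) = 1"
    using inv_euler_partial [of m] True by (simp only: n euler_partial_Suc ac_simps)
  moreover have "euler_partial n * inv_euler_partial (m - 1) = 1"
    using inv_euler_partial [of "m - 1"] True by (simp add: n_def)
  moreover have "euler_partial n \<noteq> 0"
    by (rule fps_nonzero_if_nth [of _ 0]) simp
  ultimately show ?thesis by (metis fps_cancel_left)
next
  case False
  then show ?thesis by (cases "m = 0") (simp_all add: inv_euler_partial_def)
qed

text \<open>This is \<open>q^(j^2)\<close> times the Gaussian binomial coefficient \<open>2n\<close> over \<open>n + j\<close> to the base \<open>q^2\<close>.\<close>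

definition jtp_coeff :: "nat \<Rightarrow> int \<Rightarrow> int fps" where
  "jtp_coeff n j = fps_X ^ nat (j\<^sup>2) * dil 2 (euler_partial (2 * n) *
    inv_euler_partial (int n + j) * inv_euler_partial (int n - j))"

lemma jtp_coeff_outside: "\<bar>j\<bar> > int n \<Longrightarrow> jtp_coeff n j = 0"
  by (auto simp: jtp_coeff_def inv_euler_partial_def dil_def abs_if split: if_splits)

lemma jtp_coeff_uminus: "jtp_coeff n (- j) = jtp_coeff n j"
  by (simp add: jtp_coeff_def ac_simps)

text \<open>Divided by the common factor, this is the identity
  \<open>(1 - Qxy)(1 - Q^2 xy) = (1 + Qxy)(1 - Qx)(1 - Qy) + Qy(1 - x)(1 - Qx) + Qx(1 - y)(1 - Qy)\<close> for
  \<open>Q = q^2\<close>, \<open>x = Q^(n+j)\<close>, \<open>y = Q^(n-j)\<close>. At the boundary \<open>j = \<plusminus>(n + 1)\<close> one neighbour remains.\<close>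

lemma jtp_coeff_Suc:
  "jtp_coeff (Suc n) j = (1 + fps_X ^ (4 * n + 2)) * jtp_coeff n j +
    fps_X ^ (2 * n + 1) * (jtp_coeff n (j - 1) + jtp_coeff n (j + 1))"
proof -
  have edge: "jtp_coeff (Suc n) (int (Suc n)) = fps_X ^ (2 * n + 1) * jtp_coeff n (int n)"
  proof -
    have "jtp_coeff m (int m) = fps_X ^ (m\<^sup>2)" for m
    proof -
      have "euler_partial (2 * m) * inv_euler_partial (int m + int m) = 1"
      proof -
        have "nat (int m + int m) = 2 * m" by simp
        with inv_euler_partial [of "int m + int m"] show ?thesis by (metis add_nonneg_nonneg of_nat_0_le_iff)
      qed
      moreover have "inv_euler_partial (int m - int m) = 1"
        using inv_euler_partial [of 0] by (simp add: euler_partial_def)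
      moreover have "nat ((int m)\<^sup>2) = m\<^sup>2"
        by (simp add: nat_power_eq)
      ultimately show ?thesis
        by (simp only: jtp_coeff_def dil_1 mult_1_right mult_1_left)
    qed
    moreover have "(Suc n)\<^sup>2 = (2 * n + 1) + n\<^sup>2"
      by (simp add: power2_eq_square)
    ultimately show ?thesis
      by (simp only: power_add)
  qed
  consider "\<bar>j\<bar> > int (Suc n)" | "j = int (Suc n)" | "j = - int (Suc n)" | "\<bar>j\<bar> \<le> int n"
    by linarith
  then show ?thesis
  proof cases
    case 1
    then show ?thesis by (simp add: jtp_coeff_outside)
  next
    case 2
    have "jtp_coeff n j = 0" "jtp_coeff n (j + 1) = 0"
      using 2 by (simp_all add: jtp_coeff_outside)
    then show ?thesis using edge by (simp add: 2)
  next
    case 3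
    have "jtp_coeff n j = 0" "jtp_coeff n (j - 1) = 0"
      using 3 by (simp_all add: jtp_coeff_outside)
    moreover have "jtp_coeff n (j + 1) = jtp_coeff n (int n)" "jtp_coeff (Suc n) j = jtp_coeff (Suc n) (int (Suc n))"
      using jtp_coeff_uminus [of n "int n"] jtp_coeff_uminus [of "Suc n" "int (Suc n)"] 3 by simp_all
    ultimately show ?thesis using edge by simp
  next
    case 4
    define k l where "k = nat (int n + j)" and "l = nat (int n - j)"
    have kl: "int k = int n + j" "int l = int n - j" "k + l = 2 * n"
      using 4 by (simp_all add: k_def l_def)
    define I J P where "I = dil 2 (inv_euler_partial (int n + 1 + j))"
      and "J = dil 2 (inv_euler_partial (int n + 1 - j))" and "P = dil 2 (euler_partial (2 * n))"
    define Q x y :: "int fps" where "Q = fps_X\<^sup>2" and "x = Q ^ k" and "y = Q ^ l"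
    have step: "dil 2 (inv_euler_partial (m - 1)) = (1 - Q ^ nat m) * dil 2 (inv_euler_partial m)" for m
      by (simp add: inv_euler_partial_diff_1 dil_simps Q_def)
    have suc: "nat (int n + 1 + j) = Suc k" "nat (int n + 1 - j) = Suc l" "nat (int n + j) = k" "nat (int n - j) = l"
      using kl by simp_all
    have shift: "int n + 1 + j - 1 = int n + j" "int n + 1 - j - 1 = int n - j"
      by simp_all
    have I1: "dil 2 (inv_euler_partial (int n + j)) = (1 - Q * x) * I"
      using step [of "int n + 1 + j"] by (simp only: suc shift I_def x_def power_Suc)
    have J1: "dil 2 (inv_euler_partial (int n - j)) = (1 - Q * y) * J"
      using step [of "int n + 1 - j"] by (simp only: suc shift J_def y_def power_Suc)
    have I2: "dil 2 (inv_euler_partial (int n + j - 1)) = (1 - x) * ((1 - Q * x) * I)"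
      using step [of "int n + j"] by (simp only: suc I1 x_def)
    have J2: "dil 2 (inv_euler_partial (int n - j - 1)) = (1 - y) * ((1 - Q * y) * J)"
      using step [of "int n - j"] by (simp only: suc J1 y_def)
    have xy: "Q ^ (2 * n) = x * y"
      by (simp add: x_def y_def flip: kl(3) power_add)
    have P: "dil 2 (euler_partial (2 * Suc n)) = P * (1 - Q * (x * y)) * (1 - Q\<^sup>2 * (x * y))"
      by (simp add: euler_partial_Suc dil_simps P_def xy [symmetric] Q_def eval_nat_numeral)
    define Y where "Y = fps_X ^ nat (j\<^sup>2) * P * I * J"
    have c: "jtp_coeff n j = Y * ((1 - Q * x) * (1 - Q * y))"
      by (simp only: jtp_coeff_def dil_mult zero_less_numeral I1 J1) (simp only: P_def Y_def ac_simps)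
    have c': "jtp_coeff (Suc n) j = Y * ((1 - Q * (x * y)) * (1 - Q\<^sup>2 * (x * y)))"
    proof -
      have "int (Suc n) + j = int n + 1 + j" "int (Suc n) - j = int n + 1 - j" by simp_all
      then show ?thesis
        by (simp only: jtp_coeff_def dil_mult zero_less_numeral P I_def [symmetric] J_def [symmetric])
          (simp only: Y_def ac_simps)
    qed
    have exp_minus: "fps_X ^ (2 * n + 1) * fps_X ^ nat ((j - 1)\<^sup>2) = fps_X ^ nat (j\<^sup>2) * (Q * y)"
    proof -
      have "2 * int n + 1 + (j - 1)\<^sup>2 = j\<^sup>2 + 2 * (1 + int l)"
        using kl by (simp add: power2_eq_square algebra_simps)
      then have "int (2 * n + 1 + nat ((j - 1)\<^sup>2)) = int (nat (j\<^sup>2) + 2 * Suc l)"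
        by simp
      then have "2 * n + 1 + nat ((j - 1)\<^sup>2) = nat (j\<^sup>2) + 2 * Suc l" by (simp only: of_nat_eq_iff)
      then show ?thesis
        by (simp only: Q_def y_def power_Suc [symmetric]) (simp only: power_mult [symmetric] power_add [symmetric])
    qed
    have exp_plus: "fps_X ^ (2 * n + 1) * fps_X ^ nat ((j + 1)\<^sup>2) = fps_X ^ nat (j\<^sup>2) * (Q * x)"
    proof -
      have "2 * int n + 1 + (j + 1)\<^sup>2 = j\<^sup>2 + 2 * (1 + int k)"
        using kl by (simp add: power2_eq_square algebra_simps)
      then have "int (2 * n + 1 + nat ((j + 1)\<^sup>2)) = int (nat (j\<^sup>2) + 2 * Suc k)"
        by simp
      then have "2 * n + 1 + nat ((j + 1)\<^sup>2) = nat (j\<^sup>2) + 2 * Suc k" by (simp only: of_nat_eq_iff)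
      then show ?thesis
        by (simp only: Q_def x_def power_Suc [symmetric]) (simp only: power_mult [symmetric] power_add [symmetric])
    qed
    have c_minus: "fps_X ^ (2 * n + 1) * jtp_coeff n (j - 1) = Y * (Q * y * ((1 - x) * (1 - Q * x)))"
    proof -
      have "int n + (j - 1) = int n + j - 1" "int n - (j - 1) = int n + 1 - j" by simp_all
      then have "jtp_coeff n (j - 1) = fps_X ^ nat ((j - 1)\<^sup>2) * (P * ((1 - x) * ((1 - Q * x) * I)) * J)"
        by (simp only: jtp_coeff_def dil_mult zero_less_numeral I2 J_def [symmetric] P_def [symmetric])
      then have "fps_X ^ (2 * n + 1) * jtp_coeff n (j - 1) =
          (fps_X ^ (2 * n + 1) * fps_X ^ nat ((j - 1)\<^sup>2)) * (P * ((1 - x) * ((1 - Q * x) * I)) * J)"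
        by (simp only: mult.assoc)
      then show ?thesis
        unfolding exp_minus Y_def by (simp only: ac_simps)
    qed
    have c_plus: "fps_X ^ (2 * n + 1) * jtp_coeff n (j + 1) = Y * (Q * x * ((1 - y) * (1 - Q * y)))"
    proof -
      have "int n + (j + 1) = int n + 1 + j" "int n - (j + 1) = int n - j - 1" by simp_all
      then have "jtp_coeff n (j + 1) = fps_X ^ nat ((j + 1)\<^sup>2) * (P * I * ((1 - y) * ((1 - Q * y) * J)))"
        by (simp only: jtp_coeff_def dil_mult zero_less_numeral J2 I_def [symmetric] P_def [symmetric])
      then have "fps_X ^ (2 * n + 1) * jtp_coeff n (j + 1) =
          (fps_X ^ (2 * n + 1) * fps_X ^ nat ((j + 1)\<^sup>2)) * (P * I * ((1 - y) * ((1 - Q * y) * J)))"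
        by (simp only: mult.assoc)
      then show ?thesis
        unfolding exp_plus Y_def by (simp only: ac_simps)
    qed
    have exp_mid: "fps_X ^ (4 * n + 2) = Q * (x * y)"
      unfolding xy [symmetric] by (simp add: Q_def flip: power_mult power_add)
    show ?thesis
      unfolding distrib_left [of "fps_X ^ (2 * n + 1)"] c c' c_minus c_plus exp_mid by algebra
  qed
qed

text \<open>A finite form of the triple product, in which \<open>T j = z^j + z^(-j)\<close> and \<open>t = z + 1/z\<close>. Only the recurrence of
  \<open>T\<close> enters, so that roots of unity \<open>z\<close> with rational trace can be used over the integers.\<close>

lemma finite_triple_product:
  fixes t :: int and T :: "int \<Rightarrow> int"
  assumes rec: "\<And>j. T (j + 1) + T (j - 1) = t * T j" and T0: "T 0 = 2"
  shows "2 * (\<Prod>k<n. 1 + of_int t * fps_X ^ (2 * k + 1) + fps_X ^ (4 * k + 2)) =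
    (\<Sum>j=- int n..int n. of_int (T j) * jtp_coeff n j)"
proof (induction n)
  case 0
  have "inv_euler_partial 0 = 1"
    using inv_euler_partial [of 0] by (simp add: euler_partial_def)
  then show ?case
    by (simp add: T0 jtp_coeff_def euler_partial_def dil_1)
next
  case (Suc n)
  let ?I = "{- int (Suc n)..int (Suc n)}"
  let ?c = "jtp_coeff n"
  let ?S = "\<Sum>j=- int n..int n. of_int (T j) * ?c j"
  have mid: "(\<Sum>j\<in>?I. of_int (T j) * ?c j) = ?S"
    by (rule sum.mono_neutral_right) (auto simp: jtp_coeff_outside)
  have "(\<Sum>j\<in>?I. of_int (T j) * ?c (j - 1)) = (\<Sum>j\<in>{- int n - 2..int n}. of_int (T (j + 1)) * ?c j)"
    by (rule sum.reindex_bij_witness [where i = "\<lambda>j. j + 1" and j = "\<lambda>j. j - 1"]) auto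
  also have "\<dots> = (\<Sum>j=- int n..int n. of_int (T (j + 1)) * ?c j)"
    by (rule sum.mono_neutral_right) (auto simp: jtp_coeff_outside)
  finally have minus: "(\<Sum>j\<in>?I. of_int (T j) * ?c (j - 1)) = \<dots>" .
  have "(\<Sum>j\<in>?I. of_int (T j) * ?c (j + 1)) = (\<Sum>j\<in>{- int n..int n + 2}. of_int (T (j - 1)) * ?c j)"
    by (rule sum.reindex_bij_witness [where i = "\<lambda>j. j - 1" and j = "\<lambda>j. j + 1"]) auto
  also have "\<dots> = (\<Sum>j=- int n..int n. of_int (T (j - 1)) * ?c j)"
    by (rule sum.mono_neutral_right) (auto simp: jtp_coeff_outside)
  finally have plus: "(\<Sum>j\<in>?I. of_int (T j) * ?c (j + 1)) = \<dots>" .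
  have neighbours: "(\<Sum>j\<in>?I. of_int (T j) * ?c (j - 1)) + (\<Sum>j\<in>?I. of_int (T j) * ?c (j + 1)) = of_int t * ?S"
  proof -
    have "of_int (T (j + 1)) * ?c j + of_int (T (j - 1)) * ?c j = of_int t * (of_int (T j) * ?c j)" for j
      using arg_cong [OF rec [of j], of "\<lambda>i. of_int i * ?c j"] by (simp add: algebra_simps)
    then show ?thesis
      unfolding minus plus sum.distrib [symmetric] sum_distrib_left by (intro sum.cong refl)
  qed
  have "(\<Sum>j\<in>?I. of_int (T j) * jtp_coeff (Suc n) j) =
      (1 + fps_X ^ (4 * n + 2)) * (\<Sum>j\<in>?I. of_int (T j) * ?c j) + fps_X ^ (2 * n + 1) *
      ((\<Sum>j\<in>?I. of_int (T j) * ?c (j - 1)) + (\<Sum>j\<in>?I. of_int (T j) * ?c (j + 1)))"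
    by (simp only: jtp_coeff_Suc sum_distrib_left sum.distrib [symmetric])
      (intro sum.cong refl, simp only: distrib_left distrib_right ac_simps)
  also have "\<dots> = (1 + of_int t * fps_X ^ (2 * n + 1) + fps_X ^ (4 * n + 2)) * ?S"
    unfolding mid neighbours by algebra
  also have "\<dots> = (1 + of_int t * fps_X ^ (2 * n + 1) + fps_X ^ (4 * n + 2)) *
      (2 * (\<Prod>k<n. 1 + of_int t * fps_X ^ (2 * k + 1) + fps_X ^ (4 * k + 2)))"
    by (simp only: Suc.IH)
  finally show ?case
    by (simp only: prod.lessThan_Suc mult.left_commute mult.commute)
qed

definition square_theta :: "(int \<Rightarrow> int) \<Rightarrow> int fps" where
  "square_theta T = Abs_fps (\<lambda>m. \<Sum>j | j\<^sup>2 = int m. T j)"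

lemma abs_le_square_int: "\<bar>j\<bar> \<le> (j :: int)\<^sup>2"
proof (cases "j = 0")
  case False
  then have "1 \<le> \<bar>j\<bar>" by simp
  then have "\<bar>j\<bar> * 1 \<le> \<bar>j\<bar> * \<bar>j\<bar>" by (intro mult_left_mono) auto
  then show ?thesis by (simp add: power2_eq_square)
qed simp

lemma of_int_mult_nth: "(of_int c * F) $ m = c * (F :: int fps) $ m"
  by (simp flip: fps_of_int)

lemma agree_square_theta:
  "agree (Suc n) (square_theta T) (\<Sum>j=- int n..int n. of_int (T j) * fps_X ^ nat (j\<^sup>2))"
  unfolding agree_iff_nth
proof (intro allI impI)
  fix m assume "m < Suc n"
  have "(\<Sum>j=- int n..int n. of_int (T j) * fps_X ^ nat (j\<^sup>2)) $ m =
      (\<Sum>j=- int n..int n. if j\<^sup>2 = int m then T j else 0)"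
    unfolding fps_sum_nth
    by (intro sum.cong) (auto simp: of_int_mult_nth fps_X_power_nth)
  also have "\<dots> = (\<Sum>j | j\<^sup>2 = int m. T j)"
  proof -
    have "\<bar>j\<bar> \<le> int n" if "j\<^sup>2 = int m" for j :: int
      using abs_le_square_int [of j] that \<open>m < Suc n\<close> by linarith
    then have *: "{j. j\<^sup>2 = int m} = {j \<in> {- int n..int n}. j\<^sup>2 = int m}"
      by (auto simp: abs_le_iff minus_le_iff)
    show ?thesis
      by (subst *, rule sum.inter_filter [symmetric]) simp
  qed
  finally show "square_theta T $ m = (\<Sum>j=- int n..int n. of_int (T j) * fps_X ^ nat (j\<^sup>2)) $ m"
    by (simp add: square_theta_def)
qed

text \<open>The Gaussian binomial tends to \<open>1/f_2\<close> with an error of order \<open>q^(2(n - |j|) + 2)\<close>. The factor \<open>q^(j^2)\<close>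
  makes up for the loss when \<open>|j|\<close> is large, since \<open>j^2 - 2|j| \<ge> -1\<close>.\<close>

lemma agree_euler_jtp_coeff:
  assumes "\<bar>j\<bar> \<le> int n"
  shows "agree (Suc n) (dil 2 euler * jtp_coeff n j) (fps_X ^ nat (j\<^sup>2))"
proof -
  define l where "l = n - nat \<bar>j\<bar>"
  have inv: "agree (2 * Suc l) (dil 2 (euler * inv_euler_partial m)) 1" if "m \<ge> int l" for m
  proof -
    have "agree (Suc (nat m)) (euler * inv_euler_partial m) (euler_partial (nat m) * inv_euler_partial m)"
      by (intro agree_mult agree_euler_partial agree_refl)
    then have "agree (Suc l) (euler * inv_euler_partial m) 1"
      using that by (auto simp: inv_euler_partial intro: agree_mono)
    from agree_dil [OF this, of 2] show ?thesis by (simp add: dil_1)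
  qed
  have "agree (Suc (2 * n)) (euler_partial (2 * n)) euler"
    by (intro agree_sym [OF agree_euler_partial])
  then have "agree (2 * Suc l) (dil 2 (euler_partial (2 * n))) (dil 2 euler)"
    by (rule agree_mono [OF agree_dil]) (simp_all add: l_def)
  then have "agree (2 * Suc l) (dil 2 (euler_partial (2 * n)) * (dil 2 euler * dil 2 (inv_euler_partial (int n + j)) * dil 2 (inv_euler_partial (int n - j))))
     (dil 2 euler * (dil 2 euler * dil 2 (inv_euler_partial (int n + j)) * dil 2 (inv_euler_partial (int n - j))))"
    by (intro agree_mult agree_refl)
  also have "\<dots> = dil 2 (euler * inv_euler_partial (int n + j)) * dil 2 (euler * inv_euler_partial (int n - j))"
    by (simp add: dil_mult ac_simps)
  also have "agree (2 * Suc l) \<dots> (1 * 1)"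
    using assms by (intro agree_mult inv) (auto simp: l_def)
  finally have "agree (nat (j\<^sup>2) + 2 * Suc l) (fps_X ^ nat (j\<^sup>2) * (dil 2 (euler_partial (2 * n)) *
      (dil 2 euler * dil 2 (inv_euler_partial (int n + j)) * dil 2 (inv_euler_partial (int n - j)))))
      (fps_X ^ nat (j\<^sup>2) * 1)"
    by (intro agree_shift) simp
  moreover have "Suc n \<le> nat (j\<^sup>2) + 2 * Suc l"
    using abs_le_square_int [of j] assms by (simp add: l_def of_nat_diff nat_le_iff)
  ultimately show ?thesis
    by (auto simp: jtp_coeff_def dil_mult ac_simps elim!: agree_mono)
qed

theorem triple_product_agree:
  fixes t :: int and T :: "int \<Rightarrow> int"
  assumes rec: "\<And>j. T (j + 1) + T (j - 1) = t * T j" and T0: "T 0 = 2"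
  shows "agree (Suc n) (square_theta T)
    (2 * dil 2 euler * (\<Prod>k<n. 1 + of_int t * fps_X ^ (2 * k + 1) + fps_X ^ (4 * k + 2)))"
proof -
  have "2 * dil 2 euler * (\<Prod>k<n. 1 + of_int t * fps_X ^ (2 * k + 1) + fps_X ^ (4 * k + 2)) =
      (\<Sum>j=- int n..int n. of_int (T j) * (dil 2 euler * jtp_coeff n j))"
  proof -
    have "2 * dil 2 euler * (\<Prod>k<n. 1 + of_int t * fps_X ^ (2 * k + 1) + fps_X ^ (4 * k + 2)) =
        dil 2 euler * (2 * (\<Prod>k<n. 1 + of_int t * fps_X ^ (2 * k + 1) + fps_X ^ (4 * k + 2)))"
      by (simp only: ac_simps)
    also have "\<dots> = dil 2 euler * (\<Sum>j=- int n..int n. of_int (T j) * jtp_coeff n j)"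
      by (simp only: finite_triple_product [of T t n, OF rec T0])
    finally show ?thesis by (simp only: sum_distrib_left mult.left_commute)
  qed
  moreover have "agree (Suc n) \<dots> (\<Sum>j=- int n..int n. of_int (T j) * fps_X ^ nat (j\<^sup>2))"
    by (intro agree_sum agree_mult agree_refl agree_euler_jtp_coeff) auto
  ultimately show ?thesis
    by (simp only:) (rule agree_trans [OF agree_square_theta agree_sym])
qed

section \<open>The generating function as a quotient of Euler products\<close>

definition rat_fps :: "int fps \<Rightarrow> rat fps" where
  "rat_fps F = Abs_fps (\<lambda>n. of_int (F $ n))"

lemma rat_fps_nth [simp]: "rat_fps F $ n = of_int (F $ n)"
  by (simp add: rat_fps_def)

lemma rat_fps_mult: "rat_fps (F * G) = rat_fps F * rat_fps G"
  by (rule fps_ext) (simp add: fps_mult_nth)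

lemma rat_fps_prod: "rat_fps (\<Prod>i<n :: nat. F i) = (\<Prod>i<n. rat_fps (F i))"
proof (induction n)
  case 0
  show ?case by (rule fps_ext) simp
qed (simp add: rat_fps_mult)

lemma rat_fps_factor: "rat_fps (1 - fps_X ^ k) = 1 - fps_X ^ k"
  by (rule fps_ext) simp

lemma rat_fps_inject: "rat_fps F = rat_fps G \<longleftrightarrow> F = G"
  by (auto simp: fps_eq_iff)

lemma agree_rat_fps: "agree n F G \<Longrightarrow> agree n (rat_fps F) (rat_fps G)"
  by (simp add: agree_iff_nth)

definition tbar_series :: "int fps" where
  "tbar_series = Abs_fps tbar"

lemma rat_fps_tbar_series: "rat_fps tbar_series = tbar_gf"
  by (rule fps_ext) (simp add: tbar_series_def of_int_tbar)

lemma agree_tbar_gf: "agree (Suc n) tbar_gf (\<Prod>i<Suc n. tbar_factor i)"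
proof -
  have "(\<Prod>i\<le>n. tbar_factor i) $ m = (\<Prod>i\<le>m. tbar_factor i) $ m" if "m \<le> n" for m
    using that
  proof (induction n rule: dec_induct)
    case (step n)
    obtain D where D: "tbar_factor (Suc n) = 1 + fps_X ^ Suc (Suc n) * D"
      using tbar_factor_eq by blast
    have "(\<Prod>i\<le>Suc n. tbar_factor i) =
        (\<Prod>i\<le>n. tbar_factor i) + fps_X ^ Suc (Suc n) * (D * (\<Prod>i\<le>n. tbar_factor i))"
      by (simp only: prod.atMost_Suc D) (simp only: distrib_left mult_1_left ac_simps)
    then have "(\<Prod>i\<le>Suc n. tbar_factor i) $ m = (\<Prod>i\<le>n. tbar_factor i) $ m"
      using step.hyps by (simp only: fps_add_nth fps_X_power_mult_nth) simp
    with step.IH show ?case by simp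
  qed simp
  then show ?thesis
    by (auto simp: agree_iff_nth tbar_gf_nth lessThan_Suc_atMost less_Suc_eq_le)
qed

lemma agree_euler_prod:
  assumes "k > 0"
  shows "agree (Suc n) (dil k euler) (\<Prod>i<n. 1 - fps_X ^ (k * Suc i))"
proof -
  have "1 * Suc n \<le> k * Suc n"
    using assms by (intro mult_le_mono1) simp
  then have "Suc n \<le> k * Suc n" by (simp only: mult_1_left)
  from agree_mono [OF agree_dil [OF agree_euler_partial [of n] assms] this] show ?thesis
    using assms by (simp only: dil_euler_partial)
qed

text \<open>The rational factors satisfy this identity one by one; it passes to the limit because all products
  stabilise up to any given exponent.\<close>

theorem tbar_series_euler: "tbar_series * euler * dil 2 euler = dil 3 euler"
proof -
  have "agree n (rat_fps (tbar_series * euler * dil 2 euler)) (rat_fps (dil 3 euler))" for n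
  proof -
    let ?P = "\<lambda>k. \<Prod>i<Suc n. 1 - fps_X ^ (k * Suc i) :: int fps"
    let ?Q = "\<lambda>k. \<Prod>i<Suc n. 1 - fps_X ^ (k * Suc i) :: rat fps"
    have P: "agree (Suc n) (rat_fps (dil k euler)) (?Q k)" if "k > 0" for k
      using agree_mono [OF agree_rat_fps [OF agree_euler_prod [OF that, of "Suc n"]], of "Suc n"]
      by (simp only: rat_fps_prod rat_fps_factor)
    have "agree (Suc n) (tbar_gf * rat_fps (dil 1 euler) * rat_fps (dil 2 euler))
        ((\<Prod>i<Suc n. tbar_factor i) * ?Q 1 * ?Q 2)"
      by (intro agree_mult agree_tbar_gf P) simp_all
    also have "(\<Prod>i<Suc n. tbar_factor i) * ?Q 1 * ?Q 2 = ?Q 3"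
    proof -
      have "tbar_factor i * (1 - fps_X ^ (1 * Suc i)) * (1 - fps_X ^ (2 * Suc i)) = 1 - fps_X ^ (3 * Suc i)" for i
      proof -
        let ?E = "(1 - fps_X ^ (2 * (i + 1))) * (1 - fps_X ^ (i + 1)) :: rat fps"
        have E0: "?E $ 0 \<noteq> 0" by simp
        have "tbar_factor i * ?E = (1 - fps_X ^ (3 * (i + 1))) * (inverse ?E * ?E)"
          unfolding tbar_factor_def fps_divide_unit [OF E0] by (simp only: mult.assoc)
        then show ?thesis
          unfolding inverse_mult_eq_1 [OF E0] by (simp add: ac_simps)
      qed
      then show ?thesis by (simp only: prod.distrib [symmetric])
    qed
    also have "agree (Suc n) (?Q 3) (rat_fps (dil 3 euler))"
      by (rule agree_sym [OF P]) simp
    finally have "agree (Suc n) (rat_fps (tbar_series * dil 1 euler * dil 2 euler)) (rat_fps (dil 3 euler))"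
      by (simp only: rat_fps_mult rat_fps_tbar_series)
    then show ?thesis
      by (simp add: agree_iff_nth dil_1_left)
  qed
  then have "rat_fps (tbar_series * euler * dil 2 euler) = rat_fps (dil 3 euler)"
    by (rule eqI_agree)
  then show ?thesis by (simp only: rat_fps_inject)
qed

section \<open>Product formulas\<close>

definition odd_euler_partial :: "nat \<Rightarrow> int fps" where
  "odd_euler_partial n = (\<Prod>k<n. 1 - fps_X ^ (2 * k + 1))"

lemma euler_partial_even: "euler_partial (2 * n) = odd_euler_partial n * dil 2 (euler_partial n)"
proof (induction n)
  case (Suc n)
  have "euler_partial (2 * Suc n) =
      euler_partial (2 * n) * (1 - fps_X ^ (2 * n + 1)) * (1 - fps_X ^ (2 * Suc n))"
    by (simp add: euler_partial_Suc)
  also have "1 - fps_X ^ (2 * Suc n) = dil 2 (1 - fps_X ^ Suc n)"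
    by (simp only: dil_simps power_mult zero_less_numeral)
  finally show ?case
    by (simp only: Suc.IH) (simp only: euler_partial_Suc odd_euler_partial_def prod.lessThan_Suc dil_mult
        zero_less_numeral ac_simps)
qed (simp add: euler_partial_def odd_euler_partial_def dil_1)

lemma agree_euler_odd: "agree (Suc n) euler (odd_euler_partial n * dil 2 euler)"
proof -
  have "agree (Suc n) euler (odd_euler_partial n * dil 2 (euler_partial n))"
    using agree_mono [OF agree_euler_partial [of "2 * n"], of "Suc n"] by (simp add: euler_partial_even)
  moreover have "agree (Suc n) (dil 2 (euler_partial n)) (dil 2 euler)"
    using agree_euler_prod [of 2 n] by (simp add: agree_sym dil_euler_partial)
  ultimately show ?thesis
    by (meson agree_mult agree_refl agree_trans)
qed

text \<open>The triple product at \<open>z = -1\<close>: the factors \<open>1 - 2x + x^2\<close> are squares.\<close>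

lemma alt_phi_euler: "alt phi * dil 2 euler = euler\<^sup>2"
proof -
  define T :: "int \<Rightarrow> int" where "T j = (if even j then 2 else - 2)" for j
  have T: "T (j + 1) + T (j - 1) = - 2 * T j" "T 0 = 2" for j
    by (simp_all add: T_def)
  have theta: "square_theta T = 2 * alt phi"
  proof (rule fps_ext)
    fix m
    have "T j = 2 * (- 1) ^ m" if "j\<^sup>2 = int m" for j
    proof -
      have "even j \<longleftrightarrow> even m"
        using that by (metis even_power even_of_nat_iff zero_less_numeral)
      then show ?thesis by (simp add: T_def)
    qed
    then have "(\<Sum>j | j\<^sup>2 = int m. T j) = (\<Sum>j :: int | j\<^sup>2 = int m. 2 * (- 1) ^ m)"
      by (intro sum.cong) auto
    also have "\<dots> = 2 * (- 1) ^ m * int (card {j :: int. nat (j\<^sup>2) = m})"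
    proof -
      have "{j :: int. j\<^sup>2 = int m} = {j. nat (j\<^sup>2) = m}" by (auto simp: nat_eq_iff)
      then show ?thesis by simp
    qed
    finally show "square_theta T $ m = (2 * alt phi) $ m"
      by (simp add: square_theta_def alt_nth phi_def gf_nth numeral_fps_const)
  qed
  have prod: "(\<Prod>k<n. 1 + of_int (- 2) * fps_X ^ (2 * k + 1) + fps_X ^ (4 * k + 2)) = (odd_euler_partial n)\<^sup>2" for n
  proof -
    have "1 + of_int (- 2) * fps_X ^ (2 * k + 1) + fps_X ^ (4 * k + 2) = (1 - fps_X ^ (2 * k + 1) :: int fps)\<^sup>2" for k
    proof -
      have "4 * k + 2 = (2 * k + 1) * 2" by simp
      then have "fps_X ^ (4 * k + 2) = (fps_X ^ (2 * k + 1) :: int fps)\<^sup>2"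
        by (simp only: power_mult)
      then show ?thesis by (simp add: power2_diff)
    qed
    then show ?thesis
      by (simp only: odd_euler_partial_def prod_power_distrib)
  qed
  have "agree (Suc n) (2 * (alt phi * dil 2 euler)) (2 * euler\<^sup>2)" for n
  proof -
    have "agree (Suc n) (2 * alt phi * dil 2 euler) (2 * dil 2 euler * (odd_euler_partial n)\<^sup>2 * dil 2 euler)"
      using triple_product_agree [of T "- 2" n, OF T] unfolding theta prod
      by (rule agree_mult [OF _ agree_refl])
    also have "\<dots> = 2 * (odd_euler_partial n * dil 2 euler)\<^sup>2"
      by (simp add: power2_eq_square ac_simps)
    also have "agree (Suc n) \<dots> (2 * euler\<^sup>2)"
      by (intro agree_mult agree_power agree_refl agree_sym [OF agree_euler_odd])
    finally show ?thesis by (simp only: mult.assoc)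
  qed
  then have "2 * (alt phi * dil 2 euler) = 2 * euler\<^sup>2"
    by (rule eqI_agree)
  then show ?thesis by simp
qed

text \<open>The coefficients are \<open>z^j + z^(-j)\<close> for a primitive sixth root of unity \<open>z\<close>.\<close>

definition theta6 :: "int fps" where
  "theta6 = square_theta (\<lambda>j. (if 3 dvd j then 2 else - 1) * (if even j then 1 else - 1))"

text \<open>The triple product at a primitive sixth root of unity, where \<open>(1 + x + x^2)(1 - x) = 1 - x^3\<close>.\<close>

lemma theta6_euler: "theta6 * euler * dil 6 euler = 2 * (dil 2 euler)\<^sup>2 * dil 3 euler"
proof -
  define T :: "int \<Rightarrow> int" where "T j = (if 3 dvd j then 2 else - 1) * (if even j then 1 else - 1)" for j
  have T0: "T 0 = 2" by (simp add: T_def)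
  have T: "T (j + 1) + T (j - 1) = 1 * T j" for j
  proof -
    have "3 dvd j \<and> \<not> 3 dvd j + 1 \<and> \<not> 3 dvd j - 1 \<or> \<not> 3 dvd j \<and> \<not> 3 dvd j + 1 \<and> 3 dvd j - 1 \<or>
        \<not> 3 dvd j \<and> 3 dvd j + 1 \<and> \<not> 3 dvd j - 1"
      by presburger
    then show ?thesis by (elim disjE conjE) (simp_all add: T_def)
  qed
  define R where "R n = (\<Prod>k<n. 1 + of_int 1 * fps_X ^ (2 * k + 1) + fps_X ^ (4 * k + 2) :: int fps)" for n
  have prod: "R n * odd_euler_partial n = dil 3 (odd_euler_partial n)" for n
  proof (induction n)
    case (Suc n)
    define x :: "int fps" where "x = fps_X ^ (2 * n + 1)"
    have "(1 + of_int 1 * x + x\<^sup>2) * (1 - x) = 1 - x ^ 3"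
      by (simp add: algebra_simps power2_eq_square power3_eq_cube)
    also have "\<dots> = dil 3 (1 - x)"
      by (simp only: x_def dil_simps zero_less_numeral power_mult [symmetric] mult.commute)
    finally have step: "(1 + of_int 1 * x + x\<^sup>2) * (1 - x) = dil 3 (1 - x)" .
    have "4 * n + 2 = (2 * n + 1) * 2" by simp
    then have x2: "fps_X ^ (4 * n + 2) = x\<^sup>2" by (simp only: x_def power_mult)
    have "R (Suc n) * odd_euler_partial (Suc n) =
        (R n * odd_euler_partial n) * ((1 + of_int 1 * x + x\<^sup>2) * (1 - x))"
      by (simp only: R_def odd_euler_partial_def prod.lessThan_Suc x2 x_def [symmetric])
        (simp only: ac_simps)
    then show ?case
      unfolding step Suc.IH by (simp only: odd_euler_partial_def prod.lessThan_Suc dil_mult x_def zero_less_numeral)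
  qed (simp add: R_def odd_euler_partial_def dil_1)
  have "agree (Suc n) (theta6 * euler * dil 6 euler) (2 * (dil 2 euler)\<^sup>2 * dil 3 euler)" for n
  proof -
    have "agree (Suc n) (theta6 * euler * dil 6 euler)
        ((2 * dil 2 euler * R n) * (odd_euler_partial n * dil 2 euler) * dil 6 euler)"
      using triple_product_agree [of T 1 n, OF T T0] agree_euler_odd
      unfolding R_def [symmetric] T_def theta6_def [symmetric]
      by (intro agree_mult agree_refl)
    also have "\<dots> = 2 * (dil 2 euler)\<^sup>2 * dil 3 (odd_euler_partial n * dil 2 euler)"
      by (simp add: dil_mult dil_dil power2_eq_square ac_simps flip: prod)
    also have "agree (Suc n) \<dots> (2 * (dil 2 euler)\<^sup>2 * dil 3 euler)"
      by (intro agree_mult agree_refl)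
        (rule agree_mono [OF agree_dil [OF agree_sym [OF agree_euler_odd]]], simp_all)
    finally show ?thesis .
  qed
  then show ?thesis
    by (rule eqI_agree)
qed

lemma alt_theta6: "alt theta6 = square_theta (\<lambda>j. if 3 dvd j then 2 else - 1)"
proof (rule fps_ext)
  fix m
  have "(- 1) ^ m * ((if 3 dvd j then 2 else - 1) * (if even j then 1 else - 1)) = (if 3 dvd j then 2 else - 1 :: int)"
    if "j\<^sup>2 = int m" for j :: int
  proof -
    have "even j \<longleftrightarrow> even m"
      using that by (metis even_power even_of_nat_iff zero_less_numeral)
    then show ?thesis by simp
  qed
  then show "alt theta6 $ m = square_theta (\<lambda>j. if 3 dvd j then 2 else - 1) $ m"
    by (simp only: alt_nth theta6_def square_theta_def fps_nth_Abs_fps sum_distrib_left)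
      (rule sum.cong, auto)
qed

text \<open>Even exponents \<open>j^2\<close> come from even \<open>j\<close>, and \<open>z^2\<close> is a cube root of unity.\<close>

lemma sec_theta6: "sec 2 0 theta6 = dil 2 (alt theta6)"
proof (rule fps_ext)
  fix n
  let ?T = "\<lambda>j :: int. (if 3 dvd j then 2 else - 1) * (if even j then 1 else - 1) :: int"
  have lhs: "sec 2 0 theta6 $ n = (\<Sum>j | j\<^sup>2 = int (2 * n). ?T j)"
    by (simp add: theta6_def square_theta_def)
  show "sec 2 0 theta6 $ n = dil 2 (alt theta6) $ n"
  proof (cases "even n")
    case True
    then obtain k where n: "n = 2 * k" by blast
    have even: "even j" if "j\<^sup>2 = int (2 * n)" for j :: int
      using that by (metis even_power dvd_triv_left even_of_nat_iff zero_less_numeral)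
    have "(\<Sum>j | j\<^sup>2 = int (2 * n). ?T j) = (\<Sum>i | i\<^sup>2 = int k. if 3 dvd i then 2 else - 1)"
    proof (rule sum.reindex_bij_witness [where i = "\<lambda>i. 2 * i" and j = "\<lambda>j. j div 2"])
      fix j :: int assume j: "j \<in> {j. j\<^sup>2 = int (2 * n)}"
      then obtain i where i: "j = 2 * i" using even by blast
      then show "2 * (j div 2) = j" "j div 2 \<in> {i. i\<^sup>2 = int k}"
        using j by (simp_all add: n power_mult_distrib)
      have "3 dvd 2 * i \<longleftrightarrow> 3 dvd i" by presburger
      then show "(if 3 dvd j div 2 then 2 else - 1) = ?T j" by (simp add: i)
    qed (simp_all add: n power_mult_distrib)
    then show ?thesis
      unfolding lhs alt_theta6 by (simp add: n dil_nth square_theta_def)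
  next
    case False
    have "{j :: int. j\<^sup>2 = int (2 * n)} = {}"
    proof -
      have False if "j\<^sup>2 = int (2 * n)" for j :: int
      proof -
        have "even j" using that by (metis even_power dvd_triv_left even_of_nat_iff zero_less_numeral)
        then obtain i where "j = 2 * i" by blast
        with that have "int n = 2 * i\<^sup>2" by (simp add: power_mult_distrib)
        then have "even (int n)" by simp
        with \<open>odd n\<close> show False by simp
      qed
      then show ?thesis by blast
    qed
    then have "sec 2 0 theta6 $ n = 0" unfolding lhs by (simp only: sum.empty)
    then show ?thesis using False by (simp add: dil_nth)
  qed
qed

lemma euler_nonzero [simp]: "k > 0 \<Longrightarrow> dil k euler \<noteq> 0"
  by (rule fps_nonzero_if_nth [of _ 0]) simp

lemma euler_nonzero' [simp]: "euler \<noteq> 0"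
  by (rule fps_nonzero_if_nth [of _ 0]) simp

lemma phi_euler: "phi * euler\<^sup>2 * (dil 4 euler)\<^sup>2 = dil 2 euler ^ 5"
proof -
  have 2: "dil 2 (alt phi) * dil 4 euler = (dil 2 euler)\<^sup>2"
    using arg_cong [OF alt_phi_euler, of "dil 2"] by (simp add: dil_simps dil_dil)
  have "phi * euler\<^sup>2 * (dil 4 euler)\<^sup>2 = (phi * alt phi) * (dil 4 euler)\<^sup>2 * dil 2 euler"
    unfolding alt_phi_euler [symmetric] by (simp only: ac_simps)
  also have "\<dots> = (dil 2 (alt phi) * dil 4 euler)\<^sup>2 * dil 2 euler"
    unfolding phi_mult_alt_phi by (simp only: power_mult_distrib)
  also have "\<dots> = dil 2 euler ^ 5"
    unfolding 2 by (simp add: eval_nat_numeral)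
  finally show ?thesis .
qed

text \<open>The two sides \<open>F\<close> and \<open>G\<close> satisfy \<open>F(q)^2 G(q^2) = F(q^2) G(q)^2\<close>, because \<open>\<psi>(q)^2 = \<phi>(q) \<psi>(q^2)\<close>. This
  becomes a linear functional equation for \<open>F - G\<close>, which has only the zero solution.\<close>

lemma psi_euler: "psi * euler = (dil 2 euler)\<^sup>2"
proof -
  define F G where "F = psi * euler" and "G = (dil 2 euler)\<^sup>2"
  have "F\<^sup>2 * dil 2 G = (phi * euler\<^sup>2 * (dil 4 euler)\<^sup>2) * dil 2 psi"
    by (simp add: F_def G_def dil_simps dil_dil power_mult_distrib psi_square ac_simps)
  also have "\<dots> = dil 2 F * G\<^sup>2"
    unfolding phi_euler by (simp add: F_def G_def dil_mult eval_nat_numeral ac_simps)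
  finally have *: "F\<^sup>2 * dil 2 G = dil 2 F * G\<^sup>2" .
  have "F - G = 0"
  proof (rule fps_eq_0_if_dil2)
    show "(F - G) * ((F + G) * dil 2 G) = dil 2 (F - G) * G\<^sup>2"
      using * by (simp add: dil_diff algebra_simps power2_eq_square)
    show "((F + G) * dil 2 G) $ 0 \<noteq> 0" "(F - G) $ 0 = 0"
      by (simp_all add: F_def G_def fps_nth_power_0)
  qed
  then show ?thesis by (simp add: F_def G_def)
qed

lemma alt_psi_euler: "alt psi * dil 2 euler = euler * dil 4 euler"
proof -
  have 2: "dil 2 psi * dil 2 euler = (dil 4 euler)\<^sup>2"
    using arg_cong [OF psi_euler, of "dil 2"] by (simp add: dil_simps dil_dil)
  have alt2: "dil 2 (alt phi) * dil 4 euler = (dil 2 euler)\<^sup>2"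
    using arg_cong [OF alt_phi_euler, of "dil 2"] by (simp add: dil_simps dil_dil)
  have "((dil 2 euler)\<^sup>2 * dil 4 euler) * (alt psi * dil 2 euler) =
      (psi * alt psi) * (dil 2 euler * dil 4 euler) * euler"
    unfolding psi_euler [symmetric] by (simp only: ac_simps)
  also have "\<dots> = (dil 2 psi * dil 2 euler) * (dil 2 (alt phi) * dil 4 euler) * euler"
    unfolding psi_mult_alt_psi by (simp only: ac_simps)
  also have "\<dots> = ((dil 2 euler)\<^sup>2 * dil 4 euler) * (euler * dil 4 euler)"
    unfolding 2 alt2 by (simp add: power2_eq_square ac_simps)
  finally show ?thesis by (rule fps_cancel_left) simp
qed

lemma phi_psi_alt_phi: "phi * dil 2 psi * alt phi = dil 2 euler ^ 3"
proof -
  have 2: "dil 2 psi * dil 2 euler = (dil 4 euler)\<^sup>2"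
    using arg_cong [OF psi_euler, of "dil 2"] by (simp add: dil_simps dil_dil)
  have alt2: "dil 2 (alt phi) * dil 4 euler = (dil 2 euler)\<^sup>2"
    using arg_cong [OF alt_phi_euler, of "dil 2"] by (simp add: dil_simps dil_dil)
  have "(dil 2 euler * (dil 4 euler)\<^sup>2) * (phi * dil 2 psi * alt phi) =
      (phi * alt phi) * (dil 4 euler)\<^sup>2 * (dil 2 psi * dil 2 euler)"
    by (simp only: ac_simps)
  also have "\<dots> = (dil 2 (alt phi) * dil 4 euler)\<^sup>2 * (dil 2 psi * dil 2 euler)"
    unfolding phi_mult_alt_phi by (simp only: power_mult_distrib)
  also have "\<dots> = (dil 2 euler * (dil 4 euler)\<^sup>2) * dil 2 euler ^ 3"
    unfolding 2 alt2 by (simp add: eval_nat_numeral ac_simps)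
  finally show ?thesis by (rule fps_cancel_left) simp
qed

lemma alt_euler: "alt euler * euler * dil 4 euler = dil 2 euler ^ 3"
proof (rule fps_square_eq_imp_eq)
  have alt: "phi * dil 2 euler = (alt euler)\<^sup>2"
    using arg_cong [OF alt_phi_euler, of alt] by (simp add: alt_simps alt_alt alt_dil_even)
  have "(alt euler * euler * dil 4 euler)\<^sup>2 = (phi * euler\<^sup>2 * (dil 4 euler)\<^sup>2) * dil 2 euler"
    unfolding power_mult_distrib alt [symmetric] by (simp only: ac_simps)
  then show "(alt euler * euler * dil 4 euler)\<^sup>2 = (dil 2 euler ^ 3)\<^sup>2"
    unfolding phi_euler by (simp add: eval_nat_numeral)
qed (simp_all add: fps_nth_power_0)

text \<open>Replace \<open>q\<close> by \<open>-q\<close> in the product for \<open>theta6\<close> and eliminate \<open>f_1(-q) = f_2^3/(f_1 f_4)\<close>.\<close>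

lemma alt_theta6_euler:
  "alt theta6 * dil 2 euler * dil 3 euler * dil 12 euler = 2 * euler * dil 4 euler * (dil 6 euler)\<^sup>2"
proof -
  have 1: "alt theta6 * alt euler * dil 6 euler = 2 * (dil 2 euler)\<^sup>2 * dil 3 (alt euler)"
    using arg_cong [OF theta6_euler, of alt] by (simp add: alt_simps alt_dil_even alt_dil_odd)
  have 3: "dil 3 (alt euler) * dil 3 euler * dil 12 euler = dil 6 euler ^ 3"
    using arg_cong [OF alt_euler, of "dil 3"] by (simp add: dil_simps dil_dil)
  have "((dil 2 euler)\<^sup>2 * dil 6 euler) * (alt theta6 * dil 2 euler * dil 3 euler * dil 12 euler) =
      alt theta6 * dil 6 euler * dil 2 euler ^ 3 * dil 3 euler * dil 12 euler"
    by (simp add: eval_nat_numeral ac_simps)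
  also have "\<dots> = (alt theta6 * alt euler * dil 6 euler) * (euler * dil 4 euler * dil 3 euler * dil 12 euler)"
    unfolding alt_euler [symmetric] by (simp only: ac_simps)
  also have "\<dots> = 2 * (dil 2 euler)\<^sup>2 * (euler * dil 4 euler) * (dil 3 (alt euler) * dil 3 euler * dil 12 euler)"
    unfolding 1 by (simp only: ac_simps)
  also have "\<dots> = ((dil 2 euler)\<^sup>2 * dil 6 euler) * (2 * euler * dil 4 euler * (dil 6 euler)\<^sup>2)"
    unfolding 3 by (simp add: eval_nat_numeral ac_simps)
  finally show ?thesis by (rule fps_cancel_left) simp
qed

section \<open>The generating function of every fourth value\<close>

definition tbar4_series :: "int fps" where
  "tbar4_series = sec 4 0 tbar_series"

lemma sec_sec: "sec j r (sec k s F) = sec (k * j) (k * r + s) F"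
  by (rule fps_ext) (simp add: algebra_simps)

lemma sec_dil_X: "sec 2 0 (fps_X * dil 2 F) = 0"
  using sec_dil_X_power [of 0 2 1 F] by (simp add: mult.commute)

text \<open>The even part contains the factor \<open>a c - 4q b d\<close>, to which the modular equation applies.\<close>

lemma sec2_psi_psi_phi_square:
  "sec 2 0 (alt psi * dil 3 (alt psi) * phi\<^sup>2) =
    phi * dil 2 psi * alt phi * dil 3 (alt phi)"
proof -
  define a b c d where "a = phi" and "b = dil 2 psi" and "c = dil 3 phi" and "d = dil 6 psi"
  define X :: "int fps" where "X = fps_X"
  have "alt psi * dil 3 (alt psi) = dil 4 psi * dil 6 phi - X * dil 2 phi * dil 12 psi"
    using arg_cong [OF psi_psi_dil3, of alt] by (simp add: alt_simps alt_dil_even alt_dil_odd X_def)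
  then have 1: "alt psi * dil 3 (alt psi) = dil 2 (b * c) - X * dil 2 (a * d)"
    by (simp add: a_def b_def c_def d_def dil_simps dil_dil)
  have 2: "phi\<^sup>2 = dil 2 (a\<^sup>2) + 4 * X * dil 2 (b\<^sup>2)"
    unfolding phi_square by (simp add: a_def b_def dil_simps dil_dil X_def)
  have X2: "dil 2 X = X * X" by (simp add: X_def dil_X power2_eq_square)
  have "alt psi * dil 3 (alt psi) * phi\<^sup>2 =
      dil 2 (b * c * a\<^sup>2 - 4 * X * a * d * b\<^sup>2) + X * dil 2 (4 * b * c * b\<^sup>2 - a * d * a\<^sup>2)"
    unfolding 1 2 by (simp add: dil_simps X2 algebra_simps)
  then have "sec 2 0 (alt psi * dil 3 (alt psi) * phi\<^sup>2) = b * c * a\<^sup>2 - 4 * X * a * d * b\<^sup>2"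
    by (simp only: sec_add sec_dil X_def sec_dil_X zero_less_numeral simp_thms if_True add_0_right)
  also have "\<dots> = a * b * (a * c - 4 * X * b * d)"
    by (simp add: algebra_simps power2_eq_square)
  also have "a * c - 4 * X * b * d = alt phi * dil 3 (alt phi)"
    using modular_equation_3 by (simp add: a_def b_def c_def d_def X_def algebra_simps)
  finally show ?thesis by (simp only: a_def b_def ac_simps)
qed

text \<open>Two dissections modulo 2. The first is \<open>2 \<Sum> tbar(n) q^n = theta6 \<sqdot> H(q^2)\<close> with \<open>H = f_3/f_1^3\<close>, where only the
  even part of \<open>theta6\<close> matters. The second needs the even part of \<open>H\<close>, and \<open>H\<close> is
  \<open>\<psi>(-q) \<psi>(-q^3) \<phi>(q)^2\<close> times a series in \<open>q^2\<close>.\<close>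

lemma tbar4_series_euler:
  "tbar4_series * dil 12 euler * alt phi ^ 4 = dil 2 euler * dil 4 euler * dil 6 euler * dil 3 (alt phi)"
proof -
  obtain G where G: "euler * G = 1" using fps_unit_inverse [OF euler_nth_0] by blast
  define H where "H = dil 3 euler * G ^ 3"
  have H: "H * euler ^ 3 = dil 3 euler"
  proof -
    have "H * euler ^ 3 = dil 3 euler * (euler * G) ^ 3"
      by (simp only: H_def power_mult_distrib ac_simps)
    then show ?thesis by (simp add: G)
  qed
  have H2: "dil 2 H * dil 2 euler ^ 3 = dil 6 euler"
    using arg_cong [OF H, of "dil 2"] by (simp add: dil_simps dil_dil)
  have "(euler * dil 2 euler ^ 3) * (2 * tbar_series) =
      2 * (dil 2 euler)\<^sup>2 * (tbar_series * euler * dil 2 euler)"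
    by (simp add: eval_nat_numeral ac_simps)
  also have "\<dots> = theta6 * euler * (dil 2 H * dil 2 euler ^ 3)"
    unfolding tbar_series_euler H2 by (simp only: theta6_euler)
  also have "\<dots> = (euler * dil 2 euler ^ 3) * (dil 2 H * theta6)"
    by (simp only: ac_simps)
  finally have "2 * tbar_series = dil 2 H * theta6" by (rule fps_cancel_left) simp
  then have "sec 2 0 (sec 2 0 (2 * tbar_series)) = sec 2 0 (sec 2 0 (dil 2 H * theta6))"
    by simp
  also have "sec 2 0 (sec 2 0 (dil 2 H * theta6)) = alt theta6 * sec 2 0 H"
    by (simp add: sec_dil_mult sec_theta6 mult.commute [of H])
  also have "sec 2 0 (sec 2 0 (2 * tbar_series)) = 2 * tbar4_series"
    by (simp only: mult_2 sec_add sec_sec tbar4_series_def) simp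
  finally have t4: "2 * tbar4_series = alt theta6 * sec 2 0 H" .
  have psi3: "dil 3 (alt psi) * dil 6 euler = dil 3 euler * dil 12 euler"
    using arg_cong [OF alt_psi_euler, of "dil 3"] by (simp add: dil_simps dil_dil)
  have phi: "phi * euler\<^sup>2 = (dil 2 (alt phi))\<^sup>2 * dil 2 euler"
    unfolding alt_phi_euler [symmetric] phi_mult_alt_phi [symmetric] by (simp only: ac_simps)
  have "(dil 2 euler * euler ^ 4 * dil 6 euler) * (H * dil 2 (euler * dil 2 euler * dil 6 euler * alt phi ^ 4)) =
      (H * euler ^ 3) * dil 6 euler * (euler * (dil 2 euler)\<^sup>2 * dil 4 euler * dil 12 euler * dil 2 (alt phi) ^ 4)"
    by (simp add: dil_simps dil_dil eval_nat_numeral ac_simps)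
  also have "\<dots> = (euler * dil 4 euler) * (dil 3 euler * dil 12 euler) * ((dil 2 (alt phi))\<^sup>2 * dil 2 euler)\<^sup>2 * dil 6 euler"
    unfolding H by (simp add: eval_nat_numeral ac_simps)
  also have "\<dots> = (dil 2 euler * euler ^ 4 * dil 6 euler) * (dil 2 (dil 3 euler) * (alt psi * dil 3 (alt psi) * phi\<^sup>2))"
    unfolding alt_psi_euler [symmetric] psi3 [symmetric] phi [symmetric]
    by (simp add: dil_dil eval_nat_numeral ac_simps)
  finally have "H * dil 2 (euler * dil 2 euler * dil 6 euler * alt phi ^ 4) =
      dil 2 (dil 3 euler) * (alt psi * dil 3 (alt psi) * phi\<^sup>2)"
    by (rule fps_cancel_left) simp
  then have "sec 2 0 (dil 2 (euler * dil 2 euler * dil 6 euler * alt phi ^ 4) * H) =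
      sec 2 0 (dil 2 (dil 3 euler) * (alt psi * dil 3 (alt psi) * phi\<^sup>2))"
    by (simp only: mult.commute)
  then have secH: "euler * dil 2 euler * dil 6 euler * alt phi ^ 4 * sec 2 0 H =
      dil 3 euler * (dil 2 euler ^ 3 * dil 3 (alt phi))"
    by (simp only: sec_dil_mult zero_less_numeral sec2_psi_psi_phi_square phi_psi_alt_phi)
  have "(2 * (euler * (dil 2 euler)\<^sup>2 * dil 6 euler)) * (tbar4_series * dil 12 euler * alt phi ^ 4) =
      alt theta6 * dil 2 euler * dil 12 euler * (euler * dil 2 euler * dil 6 euler * alt phi ^ 4 * sec 2 0 H)"
    using arg_cong [OF t4, of "\<lambda>F. euler * (dil 2 euler)\<^sup>2 * dil 6 euler * dil 12 euler * alt phi ^ 4 * F"]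
    by (simp add: eval_nat_numeral ac_simps)
  also have "\<dots> = (alt theta6 * dil 2 euler * dil 3 euler * dil 12 euler) * (dil 2 euler ^ 3 * dil 3 (alt phi))"
    unfolding secH by (simp only: ac_simps)
  also have "\<dots> = (2 * (euler * (dil 2 euler)\<^sup>2 * dil 6 euler)) *
      (dil 2 euler * dil 4 euler * dil 6 euler * dil 3 (alt phi))"
    unfolding alt_theta6_euler by (simp add: eval_nat_numeral ac_simps)
  finally show ?thesis by (rule fps_cancel_left) simp
qed

lemma tbar4_series_theta:
  "tbar4_series * alt phi ^ 5 * dil 24 euler =
    alt phi * dil 3 (alt phi) * (dil 2 (alt psi) * dil 6 (alt psi)) * dil 4 (alt phi)"
proof -
  have psi2: "dil 2 (alt psi) * dil 4 euler = dil 2 euler * dil 8 euler"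
    using arg_cong [OF alt_psi_euler, of "dil 2"] by (simp add: dil_simps dil_dil)
  have psi6: "dil 6 (alt psi) * dil 12 euler = dil 6 euler * dil 24 euler"
    using arg_cong [OF alt_psi_euler, of "dil 6"] by (simp add: dil_simps dil_dil)
  have phi4: "dil 4 (alt phi) * dil 8 euler = (dil 4 euler)\<^sup>2"
    using arg_cong [OF alt_phi_euler, of "dil 4"] by (simp add: dil_simps dil_dil)
  have "(dil 4 euler * dil 8 euler * dil 12 euler) * (alt phi * dil 3 (alt phi) * (dil 2 (alt psi) * dil 6 (alt psi)) * dil 4 (alt phi)) =
      alt phi * dil 3 (alt phi) * (dil 2 (alt psi) * dil 4 euler) * (dil 6 (alt psi) * dil 12 euler) * (dil 4 (alt phi) * dil 8 euler)"
    by (simp only: ac_simps)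
  also have "\<dots> = (dil 4 euler * dil 8 euler) * alt phi * dil 24 euler * (dil 2 euler * dil 4 euler * dil 6 euler * dil 3 (alt phi))"
    unfolding psi2 psi6 phi4 by (simp add: power2_eq_square ac_simps)
  also have "\<dots> = (dil 4 euler * dil 8 euler * dil 12 euler) * (tbar4_series * alt phi ^ 5 * dil 24 euler)"
    unfolding tbar4_series_euler [symmetric] by (simp add: eval_nat_numeral ac_simps)
  finally show ?thesis by (rule fps_cancel_left [symmetric]) simp
qed

section \<open>Dissection modulo 4 and the congruences\<close>

lemma five_dvd_sec:
  assumes "5 dvd F" "r < k"
  shows "5 dvd sec k r F"
proof -
  obtain G where "F = 5 * G" using assms(1) by (rule dvdE)
  then have "sec k r F = 5 * sec k r G"
    using sec_dil_mult [OF assms(2), of 5 G] by (simp add: dil_numeral)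
  then show ?thesis by simp
qed

lemma freshman_dream: "5 dvd (F + G) ^ 5 - (F ^ 5 + G ^ 5 :: int fps)"
proof -
  have "(F + G) ^ 5 - (F ^ 5 + G ^ 5) = 5 * (F ^ 4 * G + 2 * F ^ 3 * G\<^sup>2 + 2 * F\<^sup>2 * G ^ 3 + F * G ^ 4)"
    by algebra
  then show ?thesis by (simp only: dvd_triv_left)
qed

text \<open>The product \<open>\<phi>(q) \<phi>(q^2)^2\<close> is \<open>\<phi>(-q^4)^4/\<phi>(-q)\<close>, so this series allows the denominator \<open>\<phi>(-q)^5\<close> to be replaced
  by one in \<open>q^4\<close>. Modulo 5 the fifth power of \<open>(p + 2r)(p^2 + 4r^2)\<close> may be taken term by term.\<close>

lemma phi_phi_dil2_fifth_power:
  fixes a b X :: "int fps"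
  defines "a \<equiv> phi" and "b \<equiv> dil 2 psi" and "X \<equiv> fps_X"
  shows "5 dvd (phi * (dil 2 phi)\<^sup>2) ^ 5 -
    dil 4 (a ^ 15) - 2 * X * dil 4 (X * a ^ 10 * b ^ 5) - 4 * X\<^sup>2 * dil 4 (X\<^sup>2 * a ^ 5 * b ^ 10) -
      8 * X ^ 3 * dil 4 (X ^ 3 * b ^ 15)"
proof -
  define p r where "p = dil 4 a" and "r = X * dil 4 b"
  have phi: "phi = p + 2 * r"
    by (subst phi_split) (simp add: p_def r_def a_def b_def X_def dil_dil)
  have phi2: "(dil 2 phi)\<^sup>2 = p\<^sup>2 + 4 * r\<^sup>2"
    unfolding phi_dil2_square by (simp add: p_def r_def a_def b_def X_def dil_dil power_mult_distrib)
  have "5 dvd (p + 2 * r) ^ 5 - (p ^ 5 + (2 * r) ^ 5)" "5 dvd (p\<^sup>2 + 4 * r\<^sup>2) ^ 5 - ((p\<^sup>2) ^ 5 + (4 * r\<^sup>2) ^ 5)"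
    by (rule freshman_dream)+
  \<comment> \<open>the last summand is the difference between the coefficients 32, 1024, 32768 and 2, 4, 8\<close>
  then have "5 dvd ((p + 2 * r) ^ 5 - (p ^ 5 + (2 * r) ^ 5)) * (p\<^sup>2 + 4 * r\<^sup>2) ^ 5 +
      (p ^ 5 + (2 * r) ^ 5) * ((p\<^sup>2 + 4 * r\<^sup>2) ^ 5 - ((p\<^sup>2) ^ 5 + (4 * r\<^sup>2) ^ 5)) +
      5 * (6 * p ^ 10 * r ^ 5 + 204 * p ^ 5 * r ^ 10 + 6552 * r ^ 15)"
    by (intro dvd_add dvd_mult dvd_mult2) simp_all
  also have "((p + 2 * r) ^ 5 - (p ^ 5 + (2 * r) ^ 5)) * (p\<^sup>2 + 4 * r\<^sup>2) ^ 5 +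
      (p ^ 5 + (2 * r) ^ 5) * ((p\<^sup>2 + 4 * r\<^sup>2) ^ 5 - ((p\<^sup>2) ^ 5 + (4 * r\<^sup>2) ^ 5)) +
      5 * (6 * p ^ 10 * r ^ 5 + 204 * p ^ 5 * r ^ 10 + 6552 * r ^ 15) =
      ((p + 2 * r) * (p\<^sup>2 + 4 * r\<^sup>2)) ^ 5 - p ^ 15 - 2 * p ^ 10 * r ^ 5 - 4 * p ^ 5 * r ^ 10 - 8 * r ^ 15"
    by algebra
  also have "p ^ 15 = dil 4 (a ^ 15)" by (simp add: p_def dil_power)
  also have "2 * p ^ 10 * r ^ 5 = 2 * X * dil 4 (X * a ^ 10 * b ^ 5)"
    by (simp add: p_def r_def X_def dil_simps power_mult_distrib eval_nat_numeral ac_simps)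
  also have "4 * p ^ 5 * r ^ 10 = 4 * X\<^sup>2 * dil 4 (X\<^sup>2 * a ^ 5 * b ^ 10)"
    by (simp add: p_def r_def X_def dil_simps power_mult_distrib eval_nat_numeral ac_simps)
  also have "8 * r ^ 15 = 8 * X ^ 3 * dil 4 (X ^ 3 * b ^ 15)"
    by (simp add: p_def r_def X_def dil_simps power_mult_distrib eval_nat_numeral ac_simps)
  finally show ?thesis
    by (simp only: phi [symmetric] phi2 [symmetric])
qed

lemma sec4_sum:
  assumes "r < 4"
  shows "sec 4 r (dil 4 P0 + fps_X * dil 4 P1 + fps_X\<^sup>2 * dil 4 P2 + fps_X ^ 3 * dil 4 P3) =
    (if r = 0 then P0 else if r = 1 then P1 else if r = 2 then P2 else P3)"
proof -
  have "sec 4 r (fps_X ^ s * dil 4 P) = (if s = r then P else 0)" if "s < 4" for s P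
    using sec_dil_X_power [OF assms that, of P] by (simp add: mult.commute)
  from this [of 0] this [of 1] this [of 2] this [of 3] show ?thesis
    using assms by (auto simp: sec_add)
qed

text \<open>The series common to the parts of the dissection at the residues 2 and 3 modulo 4 is
  \<open>e (g c d)^3 S\<close>.\<close>

context
  fixes a b c d e g X M S :: "int fps"
  defines "a \<equiv> phi" and "b \<equiv> dil 2 psi" and "c \<equiv> dil 3 phi" and "d \<equiv> dil 6 psi"
    and "e \<equiv> alt phi" and "g \<equiv> dil 3 (alt phi)" and "X \<equiv> fps_X"
    and "M \<equiv> phi * dil 3 phi + 4 * fps_X * dil 2 psi * dil 6 psi"
    and "S \<equiv> - (a ^ 11 * d * M) - 4 * X * a ^ 5 * b ^ 5 * (b\<^sup>2 * c\<^sup>2 - X * a\<^sup>2 * d\<^sup>2) + 4 * X\<^sup>2 * b ^ 11 * c * M"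
begin

private lemma M: "M = a * c + 4 * X * b * d"
  by (simp add: M_def a_def b_def c_def d_def X_def)

text \<open>There is no part at the residue 3: the two contributions \<open>\<plusminus>2 q^3 a b c d\<close> cancel.\<close>

private lemma theta_product:
  "alt phi * dil 3 (alt phi) * (dil 2 (alt psi) * dil 6 (alt psi)) =
    dil 4 (b * c * M) - 2 * X * dil 4 (b\<^sup>2 * c\<^sup>2 - X * a\<^sup>2 * d\<^sup>2) - X\<^sup>2 * dil 4 (a * d * M)"
proof -
  have 1: "alt phi = dil 4 a - 2 * X * dil 4 b"
    by (simp add: alt_phi_split a_def b_def X_def dil_dil)
  have 3: "dil 3 (alt phi) = dil 4 c - 2 * X ^ 3 * dil 4 d"
    by (simp add: alt_phi_split c_def d_def X_def dil_simps dil_dil)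
  have psi: "alt psi * dil 3 (alt psi) = dil 4 psi * dil 6 phi - X * dil 2 phi * dil 12 psi"
    using arg_cong [OF psi_psi_dil3, of alt] by (simp add: alt_simps alt_dil_even alt_dil_odd X_def)
  have 2: "dil 2 (alt psi) * dil 6 (alt psi) = dil 4 b * dil 4 c - X\<^sup>2 * dil 4 a * dil 4 d"
    using arg_cong [OF psi, of "dil 2"] by (simp add: a_def b_def c_def d_def X_def dil_simps dil_dil)
  have X: "dil 4 X = X ^ 4" by (simp add: X_def dil_X)
  show ?thesis
    unfolding 3 2 unfolding 1 M by (simp add: dil_simps X) algebra
qed

text \<open>Multiplying \<open>T\<close> by a fifth power in \<open>q^4\<close> removes both denominators: \<open>\<phi>(-q)^5\<close> because
  \<open>\<phi>(-q) \<phi>(q) \<phi>(q^2)^2 = \<phi>(-q^4)^4\<close>, and \<open>f_24\<close> because \<open>f_6^9 = (g c d)^3\<close>.\<close>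

private lemma main_eq:
  "tbar4_series * dil 4 ((e ^ 4 * (dil 6 euler)\<^sup>2) ^ 5) = dil 4 (e * (g * c * d) ^ 3) *
    (alt phi * dil 3 (alt phi) * (dil 2 (alt psi) * dil 6 (alt psi)) * (phi * (dil 2 phi)\<^sup>2) ^ 5)"
proof -
  have K: "alt phi * (phi * (dil 2 phi)\<^sup>2) = dil 4 e ^ 4"
  proof -
    have "alt phi * (phi * (dil 2 phi)\<^sup>2) = (dil 2 (phi * alt phi))\<^sup>2"
      by (simp add: phi_mult_alt_phi [symmetric] dil_simps power_mult_distrib mult.commute
          flip: mult.assoc)
    also have "\<dots> = dil 4 e ^ 4"
      unfolding phi_mult_alt_phi by (simp add: e_def dil_simps dil_dil)
    finally show ?thesis .
  qed
  have f: "dil 24 euler ^ 3 = dil 4 (g * c * d)"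
    using arg_cong [OF phi_psi_alt_phi, of "dil 12"]
    by (simp add: g_def c_def d_def dil_simps dil_dil ac_simps)
  have f2: "dil 24 euler = dil 4 (dil 6 euler)" by (simp add: dil_dil)
  have "tbar4_series * dil 4 ((e ^ 4 * (dil 6 euler)\<^sup>2) ^ 5) =
      tbar4_series * (dil 4 e ^ 4) ^ 5 * dil 24 euler ^ 10"
    by (simp add: dil_simps dil_dil power_mult_distrib)
  also have "\<dots> = (tbar4_series * alt phi ^ 5 * dil 24 euler) * (dil 24 euler ^ 3) ^ 3 * (phi * (dil 2 phi)\<^sup>2) ^ 5"
    unfolding K [symmetric] by (simp add: power_mult_distrib ac_simps flip: power_mult)
      (simp add: eval_nat_numeral ac_simps)
  also have "\<dots> = dil 4 (e * (g * c * d) ^ 3) *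
    (alt phi * dil 3 (alt phi) * (dil 2 (alt psi) * dil 6 (alt psi)) * (phi * (dil 2 phi)\<^sup>2) ^ 5)"
    unfolding tbar4_series_theta f by (simp add: e_def dil_simps ac_simps)
  finally show ?thesis .
qed

text \<open>The terms of the fifth power at the residues 0, 1, 2, 3 form a geometric progression with
  ratio \<open>2 q^5 b(q^4)^5/a(q^4)^5\<close>.
  That is why the parts at the residues 2 and 3 are proportional, given that the other factor has no part
  at the residue 3.\<close>

private lemma sections:
  "5 dvd sec 4 2 tbar4_series * (e ^ 4 * (dil 6 euler)\<^sup>2) ^ 5 - e * (g * c * d) ^ 3 * (a ^ 5 * S)"
  "5 dvd sec 4 3 tbar4_series * (e ^ 4 * (dil 6 euler)\<^sup>2) ^ 5 - e * (g * c * d) ^ 3 * (2 * X * b ^ 5 * S)"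
proof -
  define B where "B = alt phi * dil 3 (alt phi) * (dil 2 (alt psi) * dil 6 (alt psi))"
  define K where "K = (phi * (dil 2 phi)\<^sup>2) ^ 5"
  define U where "U = dil 4 (a ^ 15) + 2 * X * dil 4 (X * a ^ 10 * b ^ 5) + 4 * X\<^sup>2 * dil 4 (X\<^sup>2 * a ^ 5 * b ^ 10) +
      8 * X ^ 3 * dil 4 (X ^ 3 * b ^ 15)"
  define N where "N = b\<^sup>2 * c\<^sup>2 - X * a\<^sup>2 * d\<^sup>2"
  define P0 where "P0 = b * c * M * a ^ 15 - 16 * X ^ 4 * N * b ^ 15 - 4 * X ^ 3 * a * d * M * a ^ 5 * b ^ 10"
  define P1 where "P1 = 2 * X * b * c * M * a ^ 10 * b ^ 5 - 2 * N * a ^ 15 - 8 * X ^ 4 * a * d * M * b ^ 15"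
  have X: "dil 4 X = X ^ 4" by (simp add: X_def dil_X)
  have "5 dvd K - U"
    using phi_phi_dil2_fifth_power by (simp add: K_def U_def a_def b_def X_def algebra_simps)
  then have "5 dvd dil 4 (e * (g * c * d) ^ 3) * B * (K - U)" by (rule dvd_mult)
  also have "dil 4 (e * (g * c * d) ^ 3) * B * (K - U) =
      tbar4_series * dil 4 ((e ^ 4 * (dil 6 euler)\<^sup>2) ^ 5) - dil 4 (e * (g * c * d) ^ 3) * (B * U)"
    unfolding main_eq B_def K_def by (simp only: right_diff_distrib mult.assoc)
  also have "B * U = dil 4 P0 + X * dil 4 P1 + X\<^sup>2 * dil 4 (a ^ 5 * S) + X ^ 3 * dil 4 (2 * X * b ^ 5 * S)"
    unfolding B_def theta_product U_def P0_def P1_def S_def N_def by (simp add: dil_simps X) algebra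
  finally have *: "5 dvd sec 4 r (tbar4_series * dil 4 ((e ^ 4 * (dil 6 euler)\<^sup>2) ^ 5) -
      dil 4 (e * (g * c * d) ^ 3) * (dil 4 P0 + X * dil 4 P1 + X\<^sup>2 * dil 4 (a ^ 5 * S) + X ^ 3 * dil 4 (2 * X * b ^ 5 * S)))"
    if "r < 4" for r
    using that by (rule five_dvd_sec)
  have sec: "sec 4 r (tbar4_series * dil 4 F) = F * sec 4 r tbar4_series" if "r < 4" for r F
    using sec_dil_mult [OF that] by (simp add: mult.commute)
  show "5 dvd sec 4 2 tbar4_series * (e ^ 4 * (dil 6 euler)\<^sup>2) ^ 5 - e * (g * c * d) ^ 3 * (a ^ 5 * S)"
    using * [of 2] by (simp add: sec_diff sec sec_dil_mult X_def sec4_sum mult.commute)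
  show "5 dvd sec 4 3 tbar4_series * (e ^ 4 * (dil 6 euler)\<^sup>2) ^ 5 - e * (g * c * d) ^ 3 * (2 * X * b ^ 5 * S)"
    using * [of 3] by (simp add: sec_diff sec sec_dil_mult X_def sec4_sum mult.commute)
qed

lemma mod5_exact_sections:
  "mod5_exact (fps_X ^ 3 * sec 4 2 tbar4_series)" "mod5_exact (fps_X\<^sup>2 * sec 4 3 tbar4_series)"
proof -
  let ?D = "e ^ 4 * (dil 6 euler)\<^sup>2"
  have S: "mod5_exact (X ^ 3 * (e * (g * c * d) ^ 3 * S))"
    using mod5_exact_theta_form
    by (simp add: S_def M_def a_def b_def c_def d_def e_def g_def X_def power_mult_distrib mult.assoc)
  have D: "?D $ 0 = 1"
    by (simp add: e_def fps_nth_power_0)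
  have "mod5_exact (?D ^ 5 * (X ^ 3 * sec 4 2 tbar4_series))"
  proof (rule mod5_exact_cong)
    show "mod5_exact (a ^ 5 * (X ^ 3 * (e * (g * c * d) ^ 3 * S)))"
      using S by (rule mod5_exact_fifth_power_mult)
    show "5 dvd ?D ^ 5 * (X ^ 3 * sec 4 2 tbar4_series) - a ^ 5 * (X ^ 3 * (e * (g * c * d) ^ 3 * S))"
      using dvd_mult [OF sections(1), of "X ^ 3"] by (simp only: right_diff_distrib ac_simps)
  qed
  then show "mod5_exact (fps_X ^ 3 * sec 4 2 tbar4_series)"
    unfolding X_def by (rule mod5_exact_fifth_power_cancel) (rule D)
  have "mod5_exact (?D ^ 5 * (X\<^sup>2 * sec 4 3 tbar4_series))"
  proof (rule mod5_exact_cong)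
    show "mod5_exact (of_int 2 * (b ^ 5 * (X ^ 3 * (e * (g * c * d) ^ 3 * S))))"
      using S by (intro mod5_exact_numeral_mult mod5_exact_fifth_power_mult)
    have eq: "of_int 2 * (b ^ 5 * (X ^ 3 * (e * (g * c * d) ^ 3 * S))) =
        X\<^sup>2 * (e * (g * c * d) ^ 3 * (2 * X * b ^ 5 * S))"
      by (simp add: eval_nat_numeral ac_simps)
    show "5 dvd ?D ^ 5 * (X\<^sup>2 * sec 4 3 tbar4_series) - of_int 2 * (b ^ 5 * (X ^ 3 * (e * (g * c * d) ^ 3 * S)))"
      unfolding eq using dvd_mult [OF sections(2), of "X\<^sup>2"] by (simp only: right_diff_distrib ac_simps)
  qed
  then show "mod5_exact (fps_X\<^sup>2 * sec 4 3 tbar4_series)"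
    unfolding X_def by (rule mod5_exact_fifth_power_cancel) (rule D)
qed

end

theorem theorem1:
  fixes n :: nat
  shows "[tbar (80 * n + 40) = 0] (mod 5) \<and> [tbar (80 * n + 60) = 0] (mod 5)"
proof
  have "5 dvd (fps_X ^ 3 * sec 4 2 tbar4_series) $ (5 * (n + 1))"
    by (rule mod5_exact_nth [OF mod5_exact_sections(1)]) simp
  then show "[tbar (80 * n + 40) = 0] (mod 5)"
    by (simp add: fps_X_power_mult_nth tbar4_series_def tbar_series_def cong_0_iff algebra_simps)
  have "5 dvd (fps_X\<^sup>2 * sec 4 3 tbar4_series) $ (5 * (n + 1))"
    by (rule mod5_exact_nth [OF mod5_exact_sections(2)]) simp
  then show "[tbar (80 * n + 60) = 0] (mod 5)"
    by (simp add: fps_X_power_mult_nth tbar4_series_def tbar_series_def cong_0_iff algebra_simps)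
qed

end
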